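(* Let $m \in \mathbb{N}=\{1,2,\dots\}$ be fixed and let $B=(b_{r,s} : r,s\in[m])$ be an $m\times m$ matrix with all entries in $(0,\infty)$, where $[m]=\{1,\dots,m\}$. Let $\boldsymbol{v}=(v_1,\dots,v_m)$ and $\boldsymbol{w}=(w_1,\dots,w_m)$ be vectors with all components in $(0,\infty)$ such that $$\sum_{s=1}^m b_{r,s} v_r w_s = 1 \ \text{ for all } r\in[m], \qquad \sum_{r=1}^m b_{r,s} v_r w_s = 1 \ \text{ for all } s\in[m].$$ Let $\mathcal{T}^{(m)}=(t^{(m)}_{r,s})$ be the $m\times m$ matrix with $t^{(m)}_{r,s}=b_{r,s}v_r w_s$, let $J^{(m)}$ be the $m\times m$ matrix all of whose entries equal $1/m$, and let $I^{(m)}$ be the $m\times m$ identity matrix. For each $n\in\mathbb{N}$ let $A^{(m,n)}=(a^{(m,n)}_{i,j} : i,j\in[mn])$ be the $mn\times mn$ matrix with $a^{(m,n)}_{i,j}=b_{\lceil i/n\rceil,\lceil j/n\rceil}$. Then, as $n\to\infty$, $$\frac{1}{(mn)!}\operatorname{perm}\big(A^{(m,n)}\big) \sim \frac{m^{-mn}\left(\prod_{r=1}^m v_r\right)^{-n}\left(\prod_{s=1}^m w_s\right)^{-n}}{\sqrt{\det\left(I^{(m)}+J^{(m)}-\left(\mathcal{T}^{(m)}\right)^*\mathcal{T}^{(m)}\right)}}.$$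
   Context: The permanent of an $N\times N$ matrix $A=(a_{i,j})$ is $\operatorname{perm}(A)=\sum_{\pi\in S_N}\prod_{i=1}^N a_{i,\pi_i}$. $\lceil x\rceil$ denotes the least integer $\geq x$. $M^*$ denotes the transpose of a real matrix $M$. $f(n)\sim g(n)$ means $f(n)/g(n)\to 1$. *)

theory Defs
  imports
    "HOL-Analysis.Analysis"
    "HOL-Library.Landau_Symbols"
    "Jordan_Normal_Form.Determinant"
begin

text \<open>
  Matrices and vectors are those of Jordan_Normal_Form, whose indices start at 0: entry
  \<open>(i, j)\<close> here is entry \<open>(i + 1, j + 1)\<close> in the usual 1-based convention.
\<close>

definition permanent :: "'a mat \<Rightarrow> 'a :: comm_ring_1" where
  "permanent A = (\<Sum> p \<in> {p. p permutes {0 ..< dim_row A}}. \<Prod> i = 0 ..< dim_row A. A $$ (i, p i))"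

text \<open>
  The 1-based rule \<open>a\<^bsub>i,j\<^esub> = b\<^bsub>\<lceil>i/n\<rceil>,\<lceil>j/n\<rceil>\<^esub>\<close>, with all four indices shifted by one.
\<close>

definition block_matrix :: "real mat \<Rightarrow> nat \<Rightarrow> real mat" where
  "block_matrix B n =
     mat (dim_row B * n) (dim_col B * n)
       (\<lambda>(i, j). B $$ (nat \<lceil>real (i + 1) / real n\<rceil> - 1, nat \<lceil>real (j + 1) / real n\<rceil> - 1))"

lemma ceiling_index_eq_div:
  assumes "n > 0"
  shows "nat \<lceil>real (i + 1) / real n\<rceil> - 1 = i div n"
proof -
  have i: "real i = real n * real (i div n) + real (i mod n)"
    by (metis of_nat_add of_nat_mult mult_div_mod_eq)
  have "i mod n + 1 \<le> n" using assms by (simp add: Suc_leI)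
  then have r: "real (i mod n) + 1 \<le> real n" by linarith
  have "\<lceil>real (i + 1) / real n\<rceil> = int (i div n) + 1"
  proof (rule ceiling_unique)
    show "of_int (int (i div n) + 1) - 1 < real (i + 1) / real n"
      using assms i by (simp add: field_simps)
    show "real (i + 1) / real n \<le> of_int (int (i div n) + 1)"
      using assms i r by (simp add: field_simps)
  qed
  then show ?thesis by simp
qed

definition scaled_matrix :: "real mat \<Rightarrow> real vec \<Rightarrow> real vec \<Rightarrow> real mat" where
  "scaled_matrix B v w =
     mat (dim_row B) (dim_col B) (\<lambda>(r, s). B $$ (r, s) * vec_index v r * vec_index w s)"

definition averaging_matrix :: "nat \<Rightarrow> real mat" where
  "averaging_matrix m = mat m m (\<lambda>_. 1 / real m)"

end

theory Submission
  imports
    Defs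
    "HOL-Probability.Characteristic_Functions"
    "HOL-Real_Asymp.Real_Asymp"
begin

text \<open>
  Rescaling by \<open>v\<close> and \<open>w\<close> reduces the claim to a positive doubly stochastic matrix \<open>t\<close>. Let each of
  the \<open>mn\<close> rows independently choose a column block, a row of block \<open>r\<close> choosing block \<open>s\<close> with
  probability \<open>t r s\<close>. Up to a factor that does not depend on \<open>t\<close>, the permanent is the probability
  that every block is chosen exactly \<open>n\<close> times, which a local limit theorem evaluates: by Fourier
  inversion it is a torus integral of characteristic functions, and dominated convergence turns this
  into a Gaussian integral for the covariance \<open>I - T\<^sup>* T\<close> on the hyperplane where one frequency is
  pinned to 0. Releasing the pinned frequency adds \<open>J\<close> to the quadratic form. For the uniform matrix
  \<open>t = 1/m\<close> the permanent is \<open>(mn)! m\<^bsup>-mn\<^esup>\<close> and the determinant is 1, so dividing by this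
  case removes every \<open>t\<close>-independent factor, and Stirling's formula is not needed.
\<close>

subsection \<open>Gaussian integrals\<close>

text \<open>The integrand is a multiple of the normal density with mean \<open>- c\<close> and
  variance \<open>1 / a\<close>, which has total mass 1.\<close>

lemma nn_integral_gaussian:
  fixes a c :: real
  assumes "a > 0"
  shows "(\<integral>\<^sup>+x. ennreal (exp (- (a * (x + c)\<^sup>2) / 2)) \<partial>lborel) = ennreal (sqrt (2 * pi / a))"
proof -
  have eq: "exp (- (a * (x + c)\<^sup>2) / 2) = sqrt (2 * pi / a) * normal_density (- c) (1 / sqrt a) x" for x
    using assms by (simp add: normal_density_def power_divide real_sqrt_divide real_sqrt_mult field_simps)
  have "(\<integral>\<^sup>+x. ennreal (normal_density (- c) (1 / sqrt a) x) \<partial>lborel) = 1"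
    using assms by (subst nn_integral_eq_integral) auto
  then show ?thesis
    unfolding eq using assms by (simp add: ennreal_mult nn_integral_cmult)
qed

interpretation lborel_product: product_sigma_finite "\<lambda>_::nat. lborel :: real measure"
  by standard

text \<open>One step of block elimination on the last index: \<open>Q\<close> factors into a block
  upper triangular matrix, carrying the Schur complement and the pivot, times a unit block lower
  triangular one. Only the first contributes to the determinant.\<close>

lemma det_schur_complement:
  fixes Q :: "real mat"
  assumes Q: "Q \<in> carrier_mat (Suc k) (Suc k)" and a: "Q $$ (k, k) \<noteq> 0"
  shows "Determinant.det Q = Q $$ (k, k) *
    Determinant.det (mat k k (\<lambda>(i, j). Q $$ (i, j) - Q $$ (i, k) * Q $$ (k, j) / Q $$ (k, k)))"
proof -
  define a where "a = Q $$ (k, k)"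
  define S where "S = mat k k (\<lambda>(i, j). Q $$ (i, j) - Q $$ (i, k) * Q $$ (k, j) / a)"
  define b where "b = mat k 1 (\<lambda>(i, j). Q $$ (i, k))"
  define c where "c = mat 1 k (\<lambda>(i, j). Q $$ (k, j) / a)"
  define D where "D = mat 1 1 (\<lambda>_. a)"
  have car: "S \<in> carrier_mat k k" "b \<in> carrier_mat k 1" "c \<in> carrier_mat 1 k" "D \<in> carrier_mat 1 1"
    by (auto simp: S_def b_def c_def D_def)
  let ?P = "four_block_mat S b (0\<^sub>m 1 k) D"
  let ?R = "four_block_mat (1\<^sub>m k) (0\<^sub>m k 1) c (1\<^sub>m 1)"
  have "?P * ?R = four_block_mat (S * 1\<^sub>m k + b * c) (S * 0\<^sub>m k 1 + b * 1\<^sub>m 1)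
      (0\<^sub>m 1 k * 1\<^sub>m k + D * c) (0\<^sub>m 1 k * 0\<^sub>m k 1 + D * 1\<^sub>m 1)"
    by (rule mult_four_block_mat) (use car in auto)
  also have "\<dots> = four_block_mat (S + b * c) b (D * c) D"
    using car by simp
  also have "\<dots> = Q"
  proof (rule eq_matI)
    fix i j assume "i < dim_row Q" "j < dim_col Q"
    then have ij: "i < Suc k" "j < Suc k" using Q by auto
    have [simp]: "a \<noteq> 0" using a by (simp add: a_def)
    show "four_block_mat (S + b * c) b (D * c) D $$ (i, j) = Q $$ (i, j)"
    proof (cases "i < k"; cases "j < k")
      assume "i < k" "j < k"
      then show ?thesis
        by (simp add: S_def b_def c_def D_def scalar_prod_def)
    next
      assume "i < k" "\<not> j < k"
      moreover from this ij have "j = k" by simp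
      ultimately show ?thesis
        by (simp add: S_def b_def c_def D_def scalar_prod_def)
    next
      assume "\<not> i < k" "j < k"
      moreover from this ij have "i = k" by simp
      ultimately show ?thesis
        by (simp add: S_def b_def c_def D_def scalar_prod_def)
    next
      assume "\<not> i < k" "\<not> j < k"
      moreover from this ij have "i = k" "j = k" by simp_all
      ultimately show ?thesis
        by (simp add: S_def b_def c_def D_def scalar_prod_def a_def)
    qed
  qed (use Q car in auto)
  finally have "Determinant.det Q = Determinant.det ?P * Determinant.det ?R"
    using Determinant.det_mult[of ?P "Suc k" ?R] car by fastforce
  also have "Determinant.det ?P = Determinant.det S * Determinant.det D"
    by (rule det_four_block_mat_lower_left_zero) (use car in auto)
  also have "Determinant.det ?R = Determinant.det (1\<^sub>m k) * Determinant.det (1\<^sub>m 1)"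
    by (rule det_four_block_mat_upper_right_zero) (use car in auto)
  also have "Determinant.det D = a"
    using car by (simp add: det_single D_def)
  finally show ?thesis
    by (simp add: S_def a_def)
qed

text \<open>Completing the square in the last coordinate leaves the form of the same Schur
  complement that appears in the determinant, so integral and determinant obey one
  recursion.\<close>

lemma quadratic_form_complete_square:
  fixes Q :: "real mat" and x :: "nat \<Rightarrow> real"
  assumes sym: "\<And>i j. i < Suc k \<Longrightarrow> j < Suc k \<Longrightarrow> Q $$ (i, j) = Q $$ (j, i)"
    and a: "Q $$ (k, k) \<noteq> 0"
  shows "(\<Sum>i<Suc k. \<Sum>j<Suc k. Q $$ (i, j) * (x(k := t)) i * (x(k := t)) j) =
    (\<Sum>i<k. \<Sum>j<k. (Q $$ (i, j) - Q $$ (i, k) * Q $$ (k, j) / Q $$ (k, k)) * x i * x j)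
    + Q $$ (k, k) * (t + (\<Sum>i<k. Q $$ (i, k) * x i) / Q $$ (k, k))\<^sup>2"
proof -
  define a where "a = Q $$ (k, k)"
  define L where "L = (\<Sum>i<k. Q $$ (i, k) * x i)"
  have L': "(\<Sum>j<k. Q $$ (k, j) * x j) = L"
    unfolding L_def by (rule sum.cong) (auto simp: sym)
  have "(\<Sum>i<Suc k. \<Sum>j<Suc k. Q $$ (i, j) * (x(k := t)) i * (x(k := t)) j) =
    (\<Sum>i<k. (\<Sum>j<k. Q $$ (i, j) * x i * x j) + Q $$ (i, k) * x i * t)
     + ((\<Sum>j<k. Q $$ (k, j) * t * x j) + a * t * t)"
    by (simp add: a_def)
  also have "\<dots> = (\<Sum>i<k. \<Sum>j<k. Q $$ (i, j) * x i * x j) + L * t + (t * L + a * t * t)"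
  proof -
    have "(\<Sum>j<k. Q $$ (k, j) * t * x j) = t * L"
      unfolding L'[symmetric] sum_distrib_left by (intro sum.cong) auto
    then show ?thesis
      by (simp add: sum.distrib L_def sum_distrib_right)
  qed
  finally have lhs: "(\<Sum>i<Suc k. \<Sum>j<Suc k. Q $$ (i, j) * (x(k := t)) i * (x(k := t)) j) = \<dots>" .
  have "(\<Sum>i<k. \<Sum>j<k. (Q $$ (i, k) * Q $$ (k, j) / a) * x i * x j) = L * L / a"
    unfolding L_def sum_product sum_divide_distrib
    by (intro sum.cong refl) (simp add: sym)
  then have "(\<Sum>i<k. \<Sum>j<k. (Q $$ (i, j) - Q $$ (i, k) * Q $$ (k, j) / a) * x i * x j) =
    (\<Sum>i<k. \<Sum>j<k. Q $$ (i, j) * x i * x j) - L * L / a"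
    by (simp add: left_diff_distrib sum_subtractf)
  moreover have "X + L * t + (t * L + a * t * t) = X - L * L / a + a * (t + L / a)\<^sup>2" for X
    using a by (simp add: a_def[symmetric] power2_eq_square field_simps)
  ultimately show ?thesis
    unfolding lhs a_def[symmetric] L_def[symmetric] by simp
qed

text \<open>Induction on the dimension: integrating out the last coordinate gives a factor
  \<open>sqrt (2 * pi / a)\<close> and leaves the Gaussian of the Schur complement, which is again
  symmetric and positive definite. Positivity asks for a nonzero coordinate below \<open>k\<close>,
  since values of \<open>x\<close> beyond \<open>k\<close> do not enter the form.\<close>

lemma nn_integral_gaussian_posdef:
  fixes Q :: "real mat"
  assumes "Q \<in> carrier_mat k k"
    and "\<And>i j. i < k \<Longrightarrow> j < k \<Longrightarrow> Q $$ (i, j) = Q $$ (j, i)"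
    and "\<And>x i. i < k \<Longrightarrow> x i \<noteq> 0 \<Longrightarrow> 0 < (\<Sum>i<k. \<Sum>j<k. Q $$ (i, j) * x i * x j)"
  shows "0 < Determinant.det Q \<and>
    (\<integral>\<^sup>+x. ennreal (exp (- (\<Sum>i<k. \<Sum>j<k. Q $$ (i, j) * x i * x j) / 2)) \<partial>PiM {..<k} (\<lambda>_. lborel))
      = ennreal (sqrt ((2 * pi) ^ k / Determinant.det Q))"
  using assms
proof (induction k arbitrary: Q)
  case 0
  then show ?case
    by (simp add: PiM_empty nn_integral_count_space_finite)
next
  case (Suc k)
  define a where "a = Q $$ (k, k)"
  define S where "S = mat k k (\<lambda>(i, j). Q $$ (i, j) - Q $$ (i, k) * Q $$ (k, j) / Q $$ (k, k))"
  define L where "L = (\<lambda>x. (\<Sum>i<k. Q $$ (i, k) * x i) / Q $$ (k, k))"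
  \<comment> \<open>The pivot is the value of the form at the last unit vector.\<close>
  have a: "a > 0"
    using Suc.prems(3)[of k "\<lambda>i. if i = k then 1 else 0"] by (simp add: a_def if_distrib cong: if_cong)
  have S_eq: "(\<Sum>i<k. \<Sum>j<k. S $$ (i, j) * x i * x j) =
     (\<Sum>i<k. \<Sum>j<k. (Q $$ (i, j) - Q $$ (i, k) * Q $$ (k, j) / Q $$ (k, k)) * x i * x j)" for x
    by (intro sum.cong refl) (simp add: S_def)
  have square: "(\<Sum>i<Suc k. \<Sum>j<Suc k. Q $$ (i, j) * (x(k := t)) i * (x(k := t)) j) =
    (\<Sum>i<k. \<Sum>j<k. S $$ (i, j) * x i * x j) + a * (t + L x)\<^sup>2" for x t
    unfolding S_eq a_def L_def
    by (rule quadratic_form_complete_square) (use Suc.prems(2) a in \<open>auto simp: a_def\<close>)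
  have det: "Determinant.det Q = a * Determinant.det S"
    unfolding S_def a_def by (rule det_schur_complement) (use Suc.prems(1) a in \<open>auto simp: a_def\<close>)
  have IH: "0 < Determinant.det S \<and>
    (\<integral>\<^sup>+x. ennreal (exp (- (\<Sum>i<k. \<Sum>j<k. S $$ (i, j) * x i * x j) / 2)) \<partial>PiM {..<k} (\<lambda>_. lborel))
      = ennreal (sqrt ((2 * pi) ^ k / Determinant.det S))"
  proof (rule Suc.IH)
    show "S \<in> carrier_mat k k" by (simp add: S_def)
    show "S $$ (i, j) = S $$ (j, i)" if "i < k" "j < k" for i j
      using that Suc.prems(2) by (simp add: S_def)
    fix x :: "nat \<Rightarrow> real" and i assume i: "i < k" "x i \<noteq> 0"
    \<comment> \<open>Giving the last coordinate the value \<open>- L x\<close> annihilates the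
      completed square, so the form of \<open>S\<close> at \<open>x\<close> is a value of the form
      of \<open>Q\<close>.\<close>
    show "0 < (\<Sum>i<k. \<Sum>j<k. S $$ (i, j) * x i * x j)"
      using Suc.prems(3)[of i "x(k := - L x)"] i unfolding square by simp
  qed
  have [measurable]: "(\<lambda>x. x i) \<in> borel_measurable (PiM {..<Suc k} (\<lambda>_. lborel :: real measure))"
    if "i < Suc k" for i
    using measurable_component_singleton[of i "{..<Suc k}" "\<lambda>_. lborel :: real measure"] that by simp
  have [measurable]: "(\<lambda>x. x i) \<in> borel_measurable (PiM {..<k} (\<lambda>_. lborel :: real measure))"
    if "i < k" for i
    using measurable_component_singleton[of i "{..<k}" "\<lambda>_. lborel :: real measure"] that by simp
  have ins: "{..<Suc k} = insert k {..<k}" by auto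
  have meas: "(\<lambda>x. ennreal (exp (- (\<Sum>i<Suc k. \<Sum>j<Suc k. Q $$ (i, j) * x i * x j) / 2)))
      \<in> borel_measurable (PiM {..<Suc k} (\<lambda>_. lborel))"
    by (intro measurable_compose[OF _ measurable_ennreal] borel_measurable_exp borel_measurable_divide
        borel_measurable_uminus borel_measurable_sum borel_measurable_times) auto
  have "(\<integral>\<^sup>+x. ennreal (exp (- (\<Sum>i<Suc k. \<Sum>j<Suc k. Q $$ (i, j) * x i * x j) / 2))
        \<partial>PiM {..<Suc k} (\<lambda>_. lborel)) =
     (\<integral>\<^sup>+x. (\<integral>\<^sup>+t. ennreal (exp (- (\<Sum>i<Suc k. \<Sum>j<Suc k. Q $$ (i, j) * (x(k := t)) i * (x(k := t)) j) / 2))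
        \<partial>lborel) \<partial>PiM {..<k} (\<lambda>_. lborel))"
    using lborel_product.product_nn_integral_insert[OF _ _ meas[unfolded ins], folded ins] by simp
  also have "\<dots> = (\<integral>\<^sup>+x. ennreal (exp (- (\<Sum>i<k. \<Sum>j<k. S $$ (i, j) * x i * x j) / 2)) *
       ennreal (sqrt (2 * pi / a)) \<partial>PiM {..<k} (\<lambda>_. lborel))"
  proof (rule nn_integral_cong)
    fix x :: "nat \<Rightarrow> real"
    have "(\<integral>\<^sup>+t. ennreal (exp (- ((\<Sum>i<k. \<Sum>j<k. S $$ (i, j) * x i * x j) + a * (t + L x)\<^sup>2) / 2)) \<partial>lborel)
      = (\<integral>\<^sup>+t. ennreal (exp (- (\<Sum>i<k. \<Sum>j<k. S $$ (i, j) * x i * x j) / 2)) *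
           ennreal (exp (- (a * (t + L x)\<^sup>2) / 2)) \<partial>lborel)"
      by (intro nn_integral_cong) (simp add: ennreal_mult[symmetric] exp_add[symmetric] field_simps)
    then show "(\<integral>\<^sup>+t. ennreal (exp (- (\<Sum>i<Suc k. \<Sum>j<Suc k. Q $$ (i, j) * (x(k := t)) i * (x(k := t)) j) / 2)) \<partial>lborel)
      = ennreal (exp (- (\<Sum>i<k. \<Sum>j<k. S $$ (i, j) * x i * x j) / 2)) * ennreal (sqrt (2 * pi / a))"
      unfolding square nn_integral_gaussian[OF a, of "L x", symmetric] by (simp add: nn_integral_cmult)
  qed
  also have "\<dots> = ennreal (sqrt ((2 * pi) ^ k / Determinant.det S)) * ennreal (sqrt (2 * pi / a))"
    by (subst nn_integral_multc) (use IH in \<open>auto intro!: measurable_compose[OF _ measurable_ennreal] borel_measurable_exp borel_measurable_divide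
        borel_measurable_uminus borel_measurable_sum borel_measurable_times\<close>)
  also have "\<dots> = ennreal (sqrt ((2 * pi) ^ Suc k / Determinant.det Q))"
    using a IH by (simp add: det ennreal_mult[symmetric] real_sqrt_mult[symmetric] real_sqrt_divide[symmetric] mult_ac)
  finally show ?case
    using a IH by (simp add: det)
qed

section \<open>Translation invariance of finite products of Lebesgue measure\<close>

text \<open>A finite product measure is determined by its values on boxes. The preimage of a box
  under a translation is a box whose sides are translated, and each side keeps its length.\<close>

lemma distr_PiM_lborel_shift:
  fixes c :: real
  assumes I: "finite (I :: nat set)"
  shows "distr (PiM I (\<lambda>_. lborel)) (PiM I (\<lambda>_. lborel)) (\<lambda>x. \<lambda>i\<in>I. c + x i) = PiM I (\<lambda>_. lborel)"
proof (rule lborel_product.PiM_eqI[OF I])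
  fix A :: "nat \<Rightarrow> real set" assume A: "\<And>i. i \<in> I \<Longrightarrow> A i \<in> sets lborel"
  have [measurable]: "(\<lambda>x. \<lambda>i\<in>I. c + x i) \<in> measurable (PiM I (\<lambda>_. lborel)) (PiM I (\<lambda>_. lborel :: real measure))"
    by (intro measurable_restrict borel_measurable_add[THEN measurable_compose[OF _ measurable_ident_sets]])
      (auto intro!: measurable_component_singleton)
  have shift: "emeasure lborel ((\<lambda>x. c + x) -` X) = emeasure lborel X" if "X \<in> sets lborel" for X :: "real set"
  proof -
    have "emeasure lborel X = emeasure (distr lborel borel ((+) c)) X"
      by (simp add: lborel_distr_plus)
    also have "\<dots> = emeasure lborel ((+) c -` X)"
      using that by (subst emeasure_distr) auto
    finally show ?thesis by simp
  qed
  have pre: "(\<lambda>x. c + x) -` A i \<in> sets lborel" if "i \<in> I" for i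
    using measurable_sets[of "\<lambda>x. c + x" lborel lborel "A i"] A[OF that] by simp
  have "emeasure (distr (PiM I (\<lambda>_. lborel)) (PiM I (\<lambda>_. lborel)) (\<lambda>x. \<lambda>i\<in>I. c + x i)) (Pi\<^sub>E I A) =
     emeasure (PiM I (\<lambda>_. lborel)) ((\<lambda>x. \<lambda>i\<in>I. c + x i) -` (Pi\<^sub>E I A) \<inter> space (PiM I (\<lambda>_. lborel)))"
    using A I by (subst emeasure_distr) (auto intro!: sets_PiM_I_finite)
  also have "(\<lambda>x. \<lambda>i\<in>I. c + x i) -` (Pi\<^sub>E I A) \<inter> space (PiM I (\<lambda>_. lborel)) = Pi\<^sub>E I (\<lambda>i. (\<lambda>x. c + x) -` A i)"
    by (auto simp: space_PiM PiE_iff)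
  also have "emeasure (PiM I (\<lambda>_. lborel)) \<dots> = (\<Prod>i\<in>I. emeasure lborel (A i))"
    using pre A I by (subst lborel_product.emeasure_PiM) (auto intro!: prod.cong shift)
  finally show "emeasure (distr (PiM I (\<lambda>_. lborel)) (PiM I (\<lambda>_. lborel)) (\<lambda>x. \<lambda>i\<in>I. c + x i)) (Pi\<^sub>E I A) =
     (\<Prod>i\<in>I. emeasure lborel (A i))" .
qed simp

lemma nn_integral_PiM_lborel_shift:
  fixes c :: real
  assumes I: "finite (I :: nat set)" and f: "f \<in> borel_measurable (PiM I (\<lambda>_. lborel))"
  shows "(\<integral>\<^sup>+x. f (\<lambda>i\<in>I. c + x i) \<partial>PiM I (\<lambda>_. lborel)) = (\<integral>\<^sup>+x. f x \<partial>PiM I (\<lambda>_. lborel))"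
proof -
  have "(\<integral>\<^sup>+x. f x \<partial>PiM I (\<lambda>_. lborel)) =
    (\<integral>\<^sup>+x. f x \<partial>distr (PiM I (\<lambda>_. lborel)) (PiM I (\<lambda>_. lborel)) (\<lambda>x. \<lambda>i\<in>I. c + x i))"
    by (simp add: distr_PiM_lborel_shift[OF I])
  also have "\<dots> = (\<integral>\<^sup>+x. f (\<lambda>i\<in>I. c + x i) \<partial>PiM I (\<lambda>_. lborel))"
    using f by (intro nn_integral_distr) (auto intro!: measurable_restrict)
  finally show ?thesis by simp
qed

subsection \<open>Permanents of block matrices as sums over balanced maps\<close>

text \<open>The size is \<open>Suc d\<close>, with indices from 0 to \<open>d\<close>: the frequency
  of block \<open>d\<close> will be pinned to 0, which leaves exactly \<open>d\<close> integration
  variables.\<close>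

locale positive_doubly_stochastic =
  fixes d :: nat and t :: "nat \<Rightarrow> nat \<Rightarrow> real"
  assumes pos: "r \<le> d \<Longrightarrow> s \<le> d \<Longrightarrow> 0 < t r s"
    and row_sum: "r \<le> d \<Longrightarrow> (\<Sum>s\<le>d. t r s) = 1"
    and col_sum: "s \<le> d \<Longrightarrow> (\<Sum>r\<le>d. t r s) = 1"

text \<open>The choices of a column block for every row that can come from a permutation.
  Extensionality makes this set finite.\<close>

definition balanced :: "nat \<Rightarrow> nat \<Rightarrow> (nat \<Rightarrow> nat) set" where
  "balanced d n = {f \<in> {..<Suc d * n} \<rightarrow>\<^sub>E {..d}. \<forall>s\<le>d. card {i \<in> {..<Suc d * n}. f i = s} = n}"

lemma finite_balanced: "finite (balanced d n)"
  unfolding balanced_def by (intro finite_subset[OF _ finite_PiE[of "{..<Suc d * n}" "\<lambda>_. {..d}"]]) auto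

lemma div_le_if_less_Suc_mult: "i div n \<le> d" if "i < Suc d * n" for i n d :: nat
  using less_mult_imp_div_less[OF that] by simp

lemma card_div_fibre:
  assumes "n > 0" "s \<le> d"
  shows "card {i \<in> {..<Suc d * n}. i div n = s} = n"
proof -
  have "{i \<in> {..<Suc d * n}. i div n = s} = {s * n..<s * n + n}"
  proof (intro subset_antisym subsetI)
    fix i assume i: "i \<in> {s * n..<s * n + n}"
    then have "i div n = s"
      using assms by (intro div_nat_eqI) (auto simp: mult_ac)
    moreover have "i < Suc s * n" using i by (simp add: add.commute)
    moreover have "Suc s * n \<le> Suc d * n" using assms by (intro mult_right_mono) auto
    ultimately show "i \<in> {i \<in> {..<Suc d * n}. i div n = s}"
      using order.strict_trans2 by blast
  next
    fix i assume "i \<in> {i \<in> {..<Suc d * n}. i div n = s}"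
    then show "i \<in> {s * n..<s * n + n}"
      using assms dividend_less_div_times[of n i] by auto
  qed
  then show ?thesis by simp
qed

text \<open>Any two balanced maps differ by a permutation of their domain, so all fibres of
  \<open>p \<mapsto> (\<lambda>i. p i div n)\<close> over balanced maps have the same size.\<close>

lemma sum_permutes_eq_sum_balanced:
  assumes n: "n > 0"
  shows "\<exists>K :: nat. K > 0 \<and> (\<forall>t :: nat \<Rightarrow> nat \<Rightarrow> real.
    (\<Sum>p | p permutes {..<Suc d * n}. \<Prod>i<Suc d * n. t (i div n) (p i div n)) =
     real K * (\<Sum>f\<in>balanced d n. \<Prod>i<Suc d * n. t (i div n) (f i)))"
proof -
  let ?A = "{..<Suc d * n}"
  let ?P = "{p. p permutes ?A}"
  \<comment> \<open>\<open>D p\<close> remembers only the column block into which \<open>p\<close>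
    sends each row.\<close>
  define D where "D = (\<lambda>p. \<lambda>i\<in>?A. p i div n :: nat)"
  \<comment> \<open>The size of the fibre over the reference map \<open>i div n\<close>. It is fixed
    before any \<open>t\<close> is chosen, so it cancels when two matrices are compared.\<close>
  define K where "K = card {p \<in> ?P. D p = D id}"
  have finP: "finite ?P" by (simp add: finite_permutations)
  have D_bal: "D p \<in> balanced d n" if p: "p permutes ?A" for p
  proof -
    have "card {i \<in> ?A. D p i = s} = n" if "s \<le> d" for s
    proof -
      have "p ` {i \<in> ?A. D p i = s} = {j \<in> ?A. j div n = s}"
      proof (intro subset_antisym subsetI)
        fix j assume j: "j \<in> {j \<in> ?A. j div n = s}"
        then have "inv_into UNIV p j \<in> ?A" "p (inv_into UNIV p j) = j"
          using permutes_in_image[OF permutes_inv[OF p]] permutes_inverses[OF p] by auto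
        then show "j \<in> p ` {i \<in> ?A. D p i = s}"
          using j by (intro image_eqI[of _ _ "inv_into UNIV p j"]) (auto simp: D_def)
      next
        fix j assume "j \<in> p ` {i \<in> ?A. D p i = s}"
        then obtain i where i: "j = p i" "i \<in> ?A" "D p i = s" by blast
        then have "p i \<in> ?A" using permutes_in_image[OF p, of i] by blast
        then show "j \<in> {j \<in> ?A. j div n = s}" using i by (simp add: D_def)
      qed
      moreover have "inj_on p {i \<in> ?A. D p i = s}"
        using permutes_inj[OF p] inj_on_subset by blast
      ultimately show ?thesis
        using card_image[of p "{i \<in> ?A. D p i = s}"] card_div_fibre[OF n that] by simp
    qed
    moreover have "D p i \<le> d" if "i \<in> ?A" for i
      using permutes_in_image[OF p, of i] that by (auto simp: D_def intro: div_le_if_less_Suc_mult)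
    ultimately show ?thesis
      unfolding balanced_def by (auto simp: D_def PiE_iff)
  qed
  \<comment> \<open>A balanced \<open>f\<close> takes every value as often as the reference map
    does, so it is that map precomposed with some permutation \<sigma>. Precomposing with \<sigma>
    then maps the reference fibre bijectively onto the fibre of \<open>f\<close>.\<close>
  have card_fibre: "card {p \<in> ?P. D p = f} = K" if f: "f \<in> balanced d n" for f
  proof -
    have "image_mset f (mset_set ?A) = image_mset (\<lambda>i. i div n) (mset_set ?A)"
    proof (rule multiset_eqI)
      fix s :: nat
      have count: "count (image_mset g (mset_set ?A)) s = card {i \<in> ?A. g i = s}" for g
        by (simp add: count_image_mset vimage_def Int_def conj_commute)
      show "count (image_mset f (mset_set ?A)) s = count (image_mset (\<lambda>i. i div n) (mset_set ?A)) s"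
      proof (cases "s \<le> d")
        case True
        then show ?thesis
          using f card_div_fibre[OF n True] unfolding count by (simp add: balanced_def)
      next
        case False
        have "{i \<in> ?A. f i = s} = {}"
          using f False by (auto simp: balanced_def PiE_iff)
        moreover have "{i \<in> ?A. i div n = s} = {}"
          using False div_le_if_less_Suc_mult by fastforce
        ultimately show ?thesis unfolding count by (simp only:)
      qed
    qed
    then obtain \<sigma> where \<sigma>: "\<sigma> permutes ?A" "\<forall>x\<in>?A. f x = \<sigma> x div n"
      using image_mset_eq_implies_permutes[of ?A f "\<lambda>i. i div n"] by blast
    have f_ext: "f = (\<lambda>i\<in>?A. \<sigma> i div n)"
      using f \<sigma>(2) by (auto simp: balanced_def PiE_iff extensional_def fun_eq_iff)
    have D_iff: "D p = (\<lambda>i\<in>?A. g i) \<longleftrightarrow> (\<forall>i\<in>?A. p i div n = g i)" for p g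
      by (auto simp: D_def fun_eq_iff restrict_def)
    have D_id: "D p = D id \<longleftrightarrow> (\<forall>i\<in>?A. p i div n = i div n)" for p
      by (auto simp: D_def fun_eq_iff restrict_def)
    have D_f: "D p = f \<longleftrightarrow> (\<forall>i\<in>?A. p i div n = \<sigma> i div n)" for p
      unfolding f_ext by (rule D_iff)
    have "bij_betw (\<lambda>p. p \<circ> \<sigma>) {p \<in> ?P. D p = D id} {p \<in> ?P. D p = f}"
    proof (rule bij_betw_byWitness[where f' = "\<lambda>p. p \<circ> inv_into UNIV \<sigma>"])
      show "\<forall>a\<in>{p \<in> ?P. D p = D id}. (a \<circ> \<sigma>) \<circ> inv_into UNIV \<sigma> = a"
        using permutes_inv_o(1)[OF \<sigma>(1)] by (simp add: o_assoc[symmetric])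
      show "\<forall>a\<in>{p \<in> ?P. D p = f}. (a \<circ> inv_into UNIV \<sigma>) \<circ> \<sigma> = a"
        using permutes_inv_o(2)[OF \<sigma>(1)] by (simp add: o_assoc[symmetric])
      show "(\<lambda>p. p \<circ> \<sigma>) ` {p \<in> ?P. D p = D id} \<subseteq> {p \<in> ?P. D p = f}"
      proof (intro image_subsetI CollectI conjI)
        fix p assume "p \<in> {p \<in> ?P. D p = D id}"
        then have p: "p permutes ?A" "\<forall>i\<in>?A. p i div n = i div n" unfolding mem_Collect_eq D_id by blast+
        show "p \<circ> \<sigma> permutes ?A" by (rule permutes_compose[OF \<sigma>(1) p(1)])
        show "D (p \<circ> \<sigma>) = f"
          unfolding D_f using p(2) permutes_in_image[OF \<sigma>(1)] unfolding o_apply by blast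
      qed
      show "(\<lambda>p. p \<circ> inv_into UNIV \<sigma>) ` {p \<in> ?P. D p = f} \<subseteq> {p \<in> ?P. D p = D id}"
      proof (intro image_subsetI CollectI conjI)
        fix p assume "p \<in> {p \<in> ?P. D p = f}"
        then have p: "p permutes ?A" "\<forall>i\<in>?A. p i div n = \<sigma> i div n" unfolding mem_Collect_eq D_f by blast+
        show "p \<circ> inv_into UNIV \<sigma> permutes ?A"
          by (rule permutes_compose[OF permutes_inv[OF \<sigma>(1)] p(1)])
        show "D (p \<circ> inv_into UNIV \<sigma>) = D id"
          unfolding D_id
        proof
          fix i assume "i \<in> ?A"
          then have "inv_into UNIV \<sigma> i \<in> ?A"
            using permutes_in_image[OF permutes_inv[OF \<sigma>(1)]] by blast
          then show "(p \<circ> inv_into UNIV \<sigma>) i div n = i div n"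
            using p(2) by (simp add: permutes_inverses[OF \<sigma>(1)] del: lessThan_iff)
        qed
      qed
    qed
    then show ?thesis
      unfolding K_def by (rule bij_betw_same_card[symmetric])
  qed
  have "id \<in> {p \<in> ?P. D p = D id}" by (simp add: permutes_id)
  moreover have "finite {p \<in> ?P. D p = D id}"
    by (rule finite_subset[OF _ finP]) blast
  ultimately have "K > 0"
    unfolding K_def card_gt_0_iff by blast
  moreover have "(\<Sum>p\<in>?P. \<Prod>i\<in>?A. t (i div n) (p i div n)) =
     real K * (\<Sum>f\<in>balanced d n. \<Prod>i\<in>?A. t (i div n) (f i))" for t :: "nat \<Rightarrow> nat \<Rightarrow> real"
  proof -
    have "(\<Sum>p\<in>?P. \<Prod>i\<in>?A. t (i div n) (p i div n)) = (\<Sum>p\<in>?P. \<Prod>i\<in>?A. t (i div n) (D p i))"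
      by (intro sum.cong prod.cong) (auto simp: D_def)
    also have "\<dots> = (\<Sum>f\<in>balanced d n. \<Sum>p\<in>{p \<in> ?P. D p = f}. \<Prod>i\<in>?A. t (i div n) (D p i))"
      by (rule sum.group[symmetric]) (use finP finite_balanced D_bal in auto)
    also have "\<dots> = (\<Sum>f\<in>balanced d n. real K * (\<Prod>i\<in>?A. t (i div n) (f i)))"
    proof (rule sum.cong[OF refl])
      fix f assume f: "f \<in> balanced d n"
      have "(\<Sum>p\<in>{p \<in> ?P. D p = f}. \<Prod>i\<in>?A. t (i div n) (D p i)) =
          (\<Sum>p\<in>{p \<in> ?P. D p = f}. \<Prod>i\<in>?A. t (i div n) (f i))"
        by (rule sum.cong) auto
      then show "(\<Sum>p\<in>{p \<in> ?P. D p = f}. \<Prod>i\<in>?A. t (i div n) (D p i)) =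
          real K * (\<Prod>i\<in>?A. t (i div n) (f i))"
        unfolding sum_constant card_fibre[OF f] .
    qed
    finally show ?thesis by (simp add: sum_distrib_left)
  qed
  ultimately show ?thesis by blast
qed

subsection \<open>Fourier inversion\<close>

text \<open>Orthogonality of characters over one full period, stretched by \<open>h\<close>; it is
  applied with \<open>h = sqrt n\<close>, the scale of the central limit theorem.\<close>

lemma has_bochner_integral_cis_period:
  fixes h :: real and k :: int
  assumes h: "h > 0"
  shows "has_bochner_integral lborel
    (\<lambda>x. indicator {- (pi * h)..pi * h} x *\<^sub>R cis (of_int k * x / h))
    (if k = 0 then of_real (2 * pi * h) else 0)"
proof (cases "k = 0")
  case True
  have "has_bochner_integral lborel (\<lambda>x. indicator {- (pi * h)..pi * h} x *\<^sub>R (1 :: complex))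
     (of_real (pi * h) - of_real (- (pi * h)))"
    using h by (intro has_bochner_integral_FTC_Icc)
      (auto intro!: derivative_eq_intros simp: has_vector_derivative_def scaleR_conv_of_real)
  then show ?thesis using True by (simp add: mult.assoc)
next
  case False
  define F where "F = (\<lambda>x. (of_real (h / of_int k) / \<i>) * cis (of_int k * x / h))"
  have "has_bochner_integral lborel (\<lambda>x. indicator {- (pi * h)..pi * h} x *\<^sub>R cis (of_int k * x / h))
     (F (pi * h) - F (- (pi * h)))"
  proof (rule has_bochner_integral_FTC_Icc)
    show "- (pi * h) \<le> pi * h" using h by simp
    show "(F has_vector_derivative cis (of_int k * x / h)) (at x within {- (pi * h)..pi * h})" for x
      unfolding F_def has_vector_derivative_def using h False
      by (auto intro!: derivative_eq_intros simp: fun_eq_iff scaleR_conv_of_real field_simps)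
    show "continuous_on {- (pi * h)..pi * h} (\<lambda>x. cis (of_int k * x / h))"
      using h by (intro continuous_intros) auto
  qed
  moreover have "F (pi * h) - F (- (pi * h)) = 0"
  proof -
    \<comment> \<open>The two angles are \<open>k * pi\<close> and \<open>- k * pi\<close>: the
      cosines agree and both sines vanish.\<close>
    have "cis (of_int k * (pi * h) / h) = cis (of_int k * (- (pi * h)) / h)"
      using h by (simp add: complex_eq_iff sin_times_pi_eq_0)
    then show ?thesis by (simp add: F_def)
  qed
  ultimately show ?thesis using False by simp
qed

text \<open>The \<open>Suc d\<close> block counts have a fixed total, so \<open>d\<close> of them
  determine the last one and its frequency can be set to 0.\<close>

definition pinned :: "nat \<Rightarrow> (nat \<Rightarrow> real) \<Rightarrow> nat \<Rightarrow> real" where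
  "pinned d y s = (if s < d then y s else 0)"

text \<open>The expectation of \<open>x\<close> at the block chosen by a row of block
  \<open>r\<close>; in matrix terms, entry \<open>r\<close> of \<open>T x\<close>.\<close>

definition row_mean :: "nat \<Rightarrow> (nat \<Rightarrow> nat \<Rightarrow> real) \<Rightarrow> (nat \<Rightarrow> real) \<Rightarrow> nat \<Rightarrow> real" where
  "row_mean d t x r = (\<Sum>s\<le>d. t r s * x s)"

text \<open>The sum of the variances of \<open>x\<close> at the chosen block, one for each row
  block. For doubly stochastic \<open>t\<close> this is the quadratic form of
  \<open>I - T\<^sup>* T\<close>.\<close>

definition dispersion :: "nat \<Rightarrow> (nat \<Rightarrow> nat \<Rightarrow> real) \<Rightarrow> (nat \<Rightarrow> real) \<Rightarrow> real" where
  "dispersion d t x = (\<Sum>r\<le>d. \<Sum>s\<le>d. t r s * (x s - row_mean d t x r)\<^sup>2)"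

text \<open>The characteristic function of the vector of block counts, centred and divided by
  \<open>sqrt n\<close>. Each row is centred by its own mean, so that every factor belongs to a
  variable of mean 0.\<close>

definition char_prod :: "nat \<Rightarrow> (nat \<Rightarrow> nat \<Rightarrow> real) \<Rightarrow> nat \<Rightarrow> (nat \<Rightarrow> real) \<Rightarrow> complex" where
  "char_prod d t n x = (\<Prod>r\<le>d. (\<Sum>s\<le>d. of_real (t r s) * cis ((x s - row_mean d t x r) / sqrt n)) ^ n)"

text \<open>The torus of frequencies, enlarged by \<open>sqrt n\<close> to match the scaling in
  \<open>char_prod\<close>.\<close>

definition box_indicator :: "nat \<Rightarrow> nat \<Rightarrow> (nat \<Rightarrow> real) \<Rightarrow> real" where
  "box_indicator d n y = (\<Prod>s<d. indicator {- (pi * sqrt n)..pi * sqrt n} (y s))"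

lemma prod_div_blocks:
  fixes g :: "nat \<Rightarrow> 'a :: comm_monoid_mult"
  assumes "n > 0"
  shows "(\<Prod>i<Suc d * n. g (i div n)) = (\<Prod>r\<le>d. g r ^ n)"
proof -
  have "(\<Prod>i<Suc d * n. g (i div n)) = (\<Prod>r<Suc d. \<Prod>i\<in>{r * n..<r * n + n}. g (i div n))"
    by (rule prod.nat_group[symmetric])
  also have "\<dots> = (\<Prod>r<Suc d. \<Prod>i\<in>{r * n..<r * n + n}. g r)"
  proof (intro prod.cong refl)
    fix r i assume "i \<in> {r * n..<r * n + n}"
    then have "i div n = r"
      using assms by (intro div_nat_eqI) (auto simp: mult_ac)
    then show "g (i div n) = g r" by simp
  qed
  finally show ?thesis by (simp add: lessThan_Suc_atMost)
qed

lemma cis_sum: "finite A \<Longrightarrow> cis (\<Sum>x\<in>A. f x) = (\<Prod>x\<in>A. cis (f x))"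
  by (induction A rule: finite_induct) (auto simp: cis_mult[symmetric])

text \<open>Unit column sums say that every block is chosen \<open>n\<close> times on average; hence
  the row centrings together subtract exactly \<open>n\<close> from each count.\<close>

lemma (in positive_doubly_stochastic) sum_row_mean: "(\<Sum>r\<le>d. row_mean d t x r) = (\<Sum>s\<le>d. x s)"
proof -
  have "(\<Sum>r\<le>d. row_mean d t x r) = (\<Sum>s\<le>d. (\<Sum>r\<le>d. t r s) * x s)"
    unfolding row_mean_def by (subst sum.swap) (simp add: sum_distrib_right)
  then show ?thesis by (simp add: col_sum)
qed

text \<open>After the centring phases are pulled out, multiplying out the product over rows gives
  one term for each assignment \<open>f\<close>. Its phase depends only on how far the count of each
  block is from \<open>n\<close>.\<close>

lemma (in positive_doubly_stochastic) char_prod_expand: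
  assumes n: "n > 0"
  shows "char_prod d t n (pinned d y) =
    (\<Sum>f\<in>{..<Suc d * n} \<rightarrow>\<^sub>E {..d}. of_real (\<Prod>i<Suc d * n. t (i div n) (f i)) *
       (\<Prod>s<d. cis (of_int (int (card {i \<in> {..<Suc d * n}. f i = s}) - int n) * y s / sqrt n)))"
proof -
  let ?A = "{..<Suc d * n}"
  define x where "x = (\<lambda>s. pinned d y s / sqrt n)"
  have "char_prod d t n (pinned d y) =
    (\<Prod>r\<le>d. (cis (- row_mean d t x r) * (\<Sum>s\<le>d. of_real (t r s) * cis (x s))) ^ n)"
    unfolding char_prod_def
  proof (intro prod.cong refl arg_cong[of _ _ "\<lambda>z. z ^ n"])
    fix r
    have "row_mean d t (pinned d y) r / sqrt n = row_mean d t x r"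
      by (simp add: row_mean_def x_def sum_divide_distrib)
    then have "cis ((pinned d y s - row_mean d t (pinned d y) r) / sqrt n) = cis (- row_mean d t x r) * cis (x s)" for s
      by (simp add: cis_mult x_def diff_divide_distrib)
    then show "(\<Sum>s\<le>d. of_real (t r s) * cis ((pinned d y s - row_mean d t (pinned d y) r) / sqrt n)) =
       cis (- row_mean d t x r) * (\<Sum>s\<le>d. of_real (t r s) * cis (x s))"
      by (simp add: sum_distrib_left mult_ac)
  qed
  also have "\<dots> = (\<Prod>r\<le>d. cis (- row_mean d t x r)) ^ n * (\<Prod>r\<le>d. (\<Sum>s\<le>d. of_real (t r s) * cis (x s)) ^ n)"
    by (simp add: power_mult_distrib prod.distrib prod_power_distrib)
  also have "(\<Prod>r\<le>d. cis (- row_mean d t x r)) ^ n = cis (- (real n * (\<Sum>s\<le>d. x s)))"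
    by (simp add: cis_sum[symmetric] sum_negf sum_row_mean Complex.DeMoivre)
  also have "(\<Prod>r\<le>d. (\<Sum>s\<le>d. of_real (t r s) * cis (x s)) ^ n) =
      (\<Prod>i\<in>?A. \<Sum>s\<le>d. of_real (t (i div n) s) * cis (x s))"
    by (rule prod_div_blocks[OF n, symmetric])
  also have "\<dots> = (\<Sum>f\<in>?A \<rightarrow>\<^sub>E {..d}. \<Prod>i\<in>?A. of_real (t (i div n) (f i)) * cis (x (f i)))"
    by (rule prod_sum_PiE) auto
  finally have "char_prod d t n (pinned d y) = (\<Sum>f\<in>?A \<rightarrow>\<^sub>E {..d}. of_real (\<Prod>i\<in>?A. t (i div n) (f i)) *
       (cis (- (real n * (\<Sum>s\<le>d. x s))) * (\<Prod>i\<in>?A. cis (x (f i)))))"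
    by (simp add: sum_distrib_left prod.distrib mult_ac)
  also have "\<dots> = (\<Sum>f\<in>?A \<rightarrow>\<^sub>E {..d}. of_real (\<Prod>i\<in>?A. t (i div n) (f i)) *
       (\<Prod>s<d. cis (of_int (int (card {i \<in> ?A. f i = s}) - int n) * y s / sqrt n)))"
  proof (intro sum.cong refl arg_cong2[of _ _ _ _ "(*)"])
    fix f assume f: "f \<in> ?A \<rightarrow>\<^sub>E {..d}"
    have "(\<Sum>i\<in>?A. x (f i)) = (\<Sum>s\<le>d. \<Sum>i\<in>{i \<in> ?A. f i = s}. x (f i))"
      by (rule sum.group[symmetric]) (use f in auto)
    also have "\<dots> = (\<Sum>s\<le>d. real (card {i \<in> ?A. f i = s}) * x s)"
      by (intro sum.cong refl) simp
    finally have "- (real n * (\<Sum>s\<le>d. x s)) + (\<Sum>i\<in>?A. x (f i)) =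
        (\<Sum>s\<le>d. (real (card {i \<in> ?A. f i = s}) - real n) * x s)"
      by (simp add: left_diff_distrib sum_subtractf sum_distrib_left)
    \<comment> \<open>The term at \<open>s = d\<close> vanishes because its frequency is
      pinned.\<close>
    also have "\<dots> = (\<Sum>s<d. (real (card {i \<in> ?A. f i = s}) - real n) * x s)"
      by (simp add: lessThan_Suc_atMost[symmetric] x_def pinned_def)
    also have "\<dots> = (\<Sum>s<d. of_int (int (card {i \<in> ?A. f i = s}) - int n) * y s / sqrt n)"
      by (intro sum.cong refl) (simp add: x_def pinned_def)
    finally show "cis (- (real n * (\<Sum>s\<le>d. x s))) * (\<Prod>i\<in>?A. cis (x (f i))) =
       (\<Prod>s<d. cis (of_int (int (card {i \<in> ?A. f i = s}) - int n) * y s / sqrt n))"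
      by (simp only: cis_sum[symmetric] finite_lessThan cis_mult)
  qed
  finally show ?thesis .
qed

text \<open>Integrating the expansion coordinate by coordinate, orthogonality removes every
  assignment in which one of the first \<open>d\<close> counts differs from
  \<open>n\<close>.\<close>

lemma (in positive_doubly_stochastic) integral_box_char_prod:
  assumes n: "n > 0"
  shows "(\<integral>y. box_indicator d n y *\<^sub>R char_prod d t n (pinned d y) \<partial>PiM {..<d} (\<lambda>_. lborel)) =
    of_real ((2 * pi * sqrt n) ^ d * (\<Sum>f\<in>balanced d n. \<Prod>i<Suc d * n. t (i div n) (f i)))"
proof -
  let ?A = "{..<Suc d * n}"
  define c where "c = (\<lambda>f s. card {i \<in> ?A. f i = (s :: nat)})"
  define P where "P = (\<lambda>f. \<Prod>i\<in>?A. t (i div n) (f i))"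
  define g where "g = (\<lambda>f s x. indicator {- (pi * sqrt n)..pi * sqrt n} x *\<^sub>R cis (of_int (int (c f s) - int n) * x / sqrt n))"
  have sn: "sqrt n > 0" using n by simp
  have hb: "has_bochner_integral lborel (g f s) (if c f s = n then of_real (2 * pi * sqrt n) else 0)" for f s
    using has_bochner_integral_cis_period[OF sn, of "int (c f s) - int n"] unfolding g_def by simp
  have expand: "box_indicator d n y *\<^sub>R char_prod d t n (pinned d y) =
     (\<Sum>f\<in>?A \<rightarrow>\<^sub>E {..d}. of_real (P f) * (\<Prod>s<d. g f s (y s)))" for y
    unfolding char_prod_expand[OF n] box_indicator_def g_def scaleR_conv_of_real c_def P_def
    by (simp add: sum_distrib_left prod.distrib mult_ac)
  have int: "integrable (PiM {..<d} (\<lambda>_. lborel)) (\<lambda>y. \<Prod>s<d. g f s (y s))" for f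
    by (intro lborel_product.product_integrable_prod) (use hb in \<open>auto simp: has_bochner_integral_iff\<close>)
  have val: "(\<integral>y. (\<Prod>s<d. g f s (y s)) \<partial>PiM {..<d} (\<lambda>_. lborel)) =
      (if f \<in> balanced d n then of_real ((2 * pi * sqrt n) ^ d) else 0)" if f: "f \<in> ?A \<rightarrow>\<^sub>E {..d}" for f
  proof -
    have "(\<integral>y. (\<Prod>s<d. g f s (y s)) \<partial>PiM {..<d} (\<lambda>_. lborel)) = (\<Prod>s<d. integral\<^sup>L lborel (g f s))"
      by (intro lborel_product.product_integral_prod) (use hb in \<open>auto simp: has_bochner_integral_iff\<close>)
    also have "\<dots> = (\<Prod>s<d. if c f s = n then of_real (2 * pi * sqrt n) else 0)"
      using hb by (auto simp: has_bochner_integral_iff)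
    also have "\<dots> = (if \<forall>s<d. c f s = n then of_real ((2 * pi * sqrt n) ^ d) else 0)"
    proof (cases "\<forall>s<d. c f s = n")
      case False
      then obtain s where "s < d" "c f s \<noteq> n" by blast
      then have "\<exists>s\<in>{..<d}. (if c f s = n then of_real (2 * pi * sqrt n) else 0 :: complex) = 0" by force
      then show ?thesis using False by (subst prod_zero) auto
    qed simp
    \<comment> \<open>All counts add up to \<open>Suc d * n\<close>, so the first \<open>d\<close>
      being \<open>n\<close> forces the last one.\<close>
    also have "(\<forall>s<d. c f s = n) \<longleftrightarrow> f \<in> balanced d n"
    proof
      assume a: "\<forall>s<d. c f s = n"
      have "Suc d * n = (\<Sum>i\<in>?A. 1)" by simp
      also have "\<dots> = (\<Sum>s\<le>d. \<Sum>i\<in>{i \<in> ?A. f i = s}. 1)"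
        by (rule sum.group[symmetric]) (use f in auto)
      also have "\<dots> = (\<Sum>s<d. c f s) + c f d"
        by (simp add: c_def lessThan_Suc_atMost[symmetric])
      finally have "c f d = n" using a by simp
      then have "\<forall>s\<le>d. c f s = n" using a le_neq_implies_less by blast
      then show "f \<in> balanced d n" using f by (simp add: balanced_def c_def)
    next
      assume "f \<in> balanced d n"
      then show "\<forall>s<d. c f s = n" by (simp add: balanced_def c_def)
    qed
    finally show ?thesis .
  qed
  have "(\<integral>y. box_indicator d n y *\<^sub>R char_prod d t n (pinned d y) \<partial>PiM {..<d} (\<lambda>_. lborel)) =
     (\<Sum>f\<in>?A \<rightarrow>\<^sub>E {..d}. of_real (P f) * (\<integral>y. (\<Prod>s<d. g f s (y s)) \<partial>PiM {..<d} (\<lambda>_. lborel)))"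
    unfolding expand by (subst Bochner_Integration.integral_sum) (use int in auto)
  also have "\<dots> = (\<Sum>f\<in>?A \<rightarrow>\<^sub>E {..d}. if f \<in> balanced d n then of_real (P f) * of_real ((2 * pi * sqrt n) ^ d) else 0)"
    using val by (intro sum.cong refl) auto
  also have "\<dots> = (\<Sum>f\<in>balanced d n. of_real (P f) * of_real ((2 * pi * sqrt n) ^ d))"
    by (intro sum.mono_neutral_cong_right) (auto simp: balanced_def intro: finite_PiE)
  finally show ?thesis
    by (simp add: P_def sum_distrib_left sum_distrib_right mult_ac)
qed

subsection \<open>The local limit theorem\<close>

lemma norm_weighted_cis_sum_le_1:
  assumes "\<And>s. s \<in> S \<Longrightarrow> 0 \<le> p s" "(\<Sum>s\<in>S. p s) = 1"
  shows "norm (\<Sum>s\<in>S. of_real (p s) * cis (x s)) \<le> 1"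
proof -
  have "norm (\<Sum>s\<in>S. of_real (p s) * cis (x s)) \<le> (\<Sum>s\<in>S. p s)"
    by (rule sum_norm_le) (use assms in \<open>simp add: norm_mult\<close>)
  then show ?thesis using assms by simp
qed

lemma cis_Taylor_2: "norm (cis x - (1 + \<i> * of_real x - of_real (x\<^sup>2 / 2))) \<le> \<bar>x\<bar> ^ 3 / 6"
proof -
  have "(\<Sum>k\<le>2. (\<i> * complex_of_real x) ^ k / fact k) = 1 + \<i> * of_real x - of_real (x\<^sup>2 / 2)"
  proof -
    have "{..2 :: nat} = {0, 1, 2}" by auto
    then show ?thesis by (simp add: power_mult_distrib)
  qed
  then show ?thesis
    using iexp_approx1[of x 2] by (simp add: cis_conv_exp fact_numeral numeral_3_eq_3)
qed

text \<open>The central limit theorem for a finitely supported variable of variance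
  \<open>V\<close>. Mean 0 removes the first-order term, so the base \<open>z n\<close> is
  \<open>1 - V / (2 * n)\<close> up to order \<open>1 / (n * sqrt n)\<close>. As \<open>z n\<close>
  and \<open>w n\<close> lie in the unit disc, their \<open>n\<close>-th powers differ by at most
  \<open>n * norm (z n - w n)\<close>.\<close>

lemma weighted_cis_sum_power_tendsto:
  fixes p x :: "'a \<Rightarrow> real"
  assumes p: "\<And>s. s \<in> S \<Longrightarrow> 0 \<le> p s" and one: "(\<Sum>s\<in>S. p s) = 1" and mean: "(\<Sum>s\<in>S. p s * x s) = 0"
  shows "(\<lambda>n. (\<Sum>s\<in>S. of_real (p s) * cis (x s / sqrt n)) ^ n)
    \<longlonglongrightarrow> of_real (exp (- (\<Sum>s\<in>S. p s * (x s)\<^sup>2) / 2))"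
proof -
  define V where "V = (\<Sum>s\<in>S. p s * (x s)\<^sup>2)"
  define C where "C = (\<Sum>s\<in>S. p s * (\<bar>x s\<bar> ^ 3 / 6))"
  define z where "z = (\<lambda>n::nat. \<Sum>s\<in>S. of_real (p s) * cis (x s / sqrt n))"
  \<comment> \<open>The comparison sequence whose \<open>n\<close>-th power equals the limit exactly
    for \<open>n > 0\<close>.\<close>
  define w where "w = (\<lambda>n::nat. complex_of_real (exp (- V / (2 * real n))))"
  have V: "V \<ge> 0" unfolding V_def using p by (intro sum_nonneg) auto
  have z1: "norm (z n) \<le> 1" for n
    unfolding z_def using p one by (rule norm_weighted_cis_sum_le_1)
  have w1: "norm (w n) \<le> 1" for n
    unfolding w_def using V by (simp add: norm_of_real)
  have z_approx: "norm (z n - of_real (1 - V / (2 * real n))) \<le> C / (n * sqrt n)" if n: "n > 0" for n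
  proof -
    have "z n - of_real (1 - V / (2 * real n)) =
      (\<Sum>s\<in>S. of_real (p s) * (cis (x s / sqrt n) - (1 + \<i> * of_real (x s / sqrt n) - of_real ((x s / sqrt n)\<^sup>2 / 2))))"
    proof -
      have "(\<Sum>s\<in>S. of_real (p s) * (1 + \<i> * of_real (x s / sqrt n) - of_real ((x s / sqrt n)\<^sup>2 / 2))) =
         of_real (\<Sum>s\<in>S. p s) + \<i> * of_real ((\<Sum>s\<in>S. p s * x s) / sqrt n) - of_real (V / (2 * real n))"
        using n by (simp add: V_def algebra_simps sum.distrib sum_subtractf sum_distrib_left sum_divide_distrib power_divide)
      then show ?thesis
        by (simp add: z_def right_diff_distrib sum_subtractf one mean)
    qed
    also have "norm \<dots> \<le> (\<Sum>s\<in>S. p s * (\<bar>x s / sqrt n\<bar> ^ 3 / 6))"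
    proof (rule sum_norm_le)
      fix s assume s: "s \<in> S"
      show "norm (of_real (p s) * (cis (x s / sqrt n) - (1 + \<i> * of_real (x s / sqrt n) - of_real ((x s / sqrt n)\<^sup>2 / 2))))
          \<le> p s * (\<bar>x s / sqrt n\<bar> ^ 3 / 6)"
        unfolding norm_mult norm_of_real abs_of_nonneg[OF p[OF s]]
        by (intro mult_left_mono cis_Taylor_2 p s)
    qed
    also have "\<dots> = C / (n * sqrt n)"
      using n by (simp add: C_def sum_divide_distrib abs_divide power_divide power3_eq_cube mult_ac)
    finally show ?thesis .
  qed
  have "(\<lambda>n. C / sqrt (real n) + real n * \<bar>exp (- V / (2 * real n)) - (1 - V / (2 * real n))\<bar>) \<longlonglongrightarrow> 0"
  proof -
    have "(\<lambda>n. real n * (exp (- V / (2 * real n)) - (1 - V / (2 * real n)))) \<longlonglongrightarrow> 0"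
    \<comment> \<open>For \<open>V = 0\<close> the expression is identically 0; otherwise the sign
      of \<open>V\<close> is known for the asymptotic expansion.\<close>
    proof (cases "V = 0")
      case False
      then have "V > 0" using V by simp
      then show ?thesis by real_asymp
    qed simp
    then have "(\<lambda>n. real n * \<bar>exp (- V / (2 * real n)) - (1 - V / (2 * real n))\<bar>) \<longlonglongrightarrow> 0"
      by (drule_tac tendsto_rabs_zero) (simp add: abs_mult)
    moreover have "(\<lambda>n. C * (1 / sqrt (real n))) \<longlonglongrightarrow> 0"
      by (rule tendsto_mult_right_zero) real_asymp
    ultimately show ?thesis
      using tendsto_add_zero by fastforce
  qed
  then have "(\<lambda>n. z n ^ n - w n ^ n) \<longlonglongrightarrow> 0"
  proof (rule Lim_null_comparison[rotated])
    show "\<forall>\<^sub>F n in sequentially. norm (z n ^ n - w n ^ n) \<le>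
        C / sqrt (real n) + real n * \<bar>exp (- V / (2 * real n)) - (1 - V / (2 * real n))\<bar>"
      using eventually_gt_at_top[of 0]
    proof eventually_elim
      case (elim n)
      have "norm (z n ^ n - w n ^ n) \<le> real n * norm (z n - w n)"
        using z1 w1 by (rule norm_power_diff)
      also have "norm (z n - w n) \<le> norm (z n - of_real (1 - V / (2 * real n))) + norm (w n - of_real (1 - V / (2 * real n)))"
        by (metis dist_norm dist_triangle2)
      also have "norm (w n - of_real (1 - V / (2 * real n))) = \<bar>exp (- V / (2 * real n)) - (1 - V / (2 * real n))\<bar>"
        unfolding w_def of_real_diff[symmetric] norm_of_real by simp
      also note z_approx[OF elim]
      also have "real n * (C / (real n * sqrt (real n)) + \<bar>exp (- V / (2 * real n)) - (1 - V / (2 * real n))\<bar>) =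
         C / sqrt (real n) + real n * \<bar>exp (- V / (2 * real n)) - (1 - V / (2 * real n))\<bar>"
        using elim by (simp add: distrib_left)
      finally show ?case by (simp add: mult_left_mono)
    qed
  qed
  moreover have "(\<lambda>n. w n ^ n) \<longlonglongrightarrow> of_real (exp (- V / 2))"
  proof (rule tendsto_eventually)
    show "\<forall>\<^sub>F n in sequentially. w n ^ n = of_real (exp (- V / 2))"
      using eventually_gt_at_top[of 0]
      by eventually_elim (simp add: w_def exp_of_nat_mult[symmetric] of_real_power[symmetric] del: of_real_power)
  qed
  ultimately have "(\<lambda>n. (z n ^ n - w n ^ n) + w n ^ n) \<longlonglongrightarrow> 0 + of_real (exp (- V / 2))"
    by (rule tendsto_add)
  then show ?thesis by (simp add: z_def V_def)
qed

section \<open>A Gaussian bound on the characteristic function, uniform in \<open>n\<close>\<close>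

text \<open>With \<open>u = x / 2\<close>, \<open>1 - cos x\<close> is twice the square of
  \<open>sin u\<close>. Since \<open>pi < 4\<close> gives \<open>\<bar>u\<bar> \<le> 2\<close>, the
  cubic Taylor error is at most two thirds of \<open>\<bar>u\<bar>\<close>, so
  \<open>\<bar>sin u\<bar>\<close> is at least a third of it.\<close>

lemma one_minus_cos_ge:
  fixes x :: real
  assumes "\<bar>x\<bar> \<le> pi"
  shows "x\<^sup>2 / 18 \<le> 1 - cos x"
proof -
  define u where "u = x / 2"
  have u2: "\<bar>u\<bar> \<le> 2" using assms pi_less_4 by (simp add: u_def)
  have "\<bar>sin u - u\<bar> \<le> \<bar>u\<bar> ^ 3 / 6"
    using Maclaurin_sin_bound[of u 3] by (simp add: eval_nat_numeral sin_coeff_def)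
  moreover have "\<bar>u\<bar> ^ 3 \<le> 4 * \<bar>u\<bar>"
  proof -
    have "\<bar>u\<bar> ^ 2 \<le> 2 ^ 2" using u2 by (intro power_mono) auto
    then have "\<bar>u\<bar> ^ 2 * \<bar>u\<bar> \<le> 4 * \<bar>u\<bar>" by (intro mult_right_mono) auto
    then show ?thesis by (simp add: power3_eq_cube power2_eq_square)
  qed
  ultimately have "\<bar>u / 3\<bar> \<le> \<bar>sin u\<bar>" by linarith
  then have "(u / 3)\<^sup>2 \<le> (sin u)\<^sup>2" by (rule abs_le_square_iff[THEN iffD1])
  moreover have "cos x = 1 - 2 * (sin u)\<^sup>2"
    using cos_double_sin[of u] by (simp add: u_def)
  ultimately show ?thesis by (simp add: u_def power_divide)
qed

text \<open>The squared modulus is the mean of \<open>cos (X - X')\<close> for independent copies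
  \<open>X\<close> and \<open>X'\<close>. All terms of its defect from 1 are nonnegative, and only
  those in which the second index is \<open>d\<close> are kept.\<close>

lemma norm_weighted_cis_sum_le:
  fixes p x :: "nat \<Rightarrow> real"
  assumes p: "\<And>s. s \<le> d \<Longrightarrow> 0 \<le> p s" and one: "(\<Sum>s\<le>d. p s) = 1"
  shows "(norm (\<Sum>s\<le>d. of_real (p s) * cis (x s)))\<^sup>2 \<le> 1 - (\<Sum>s<d. p s * p d * (1 - cos (x s - x d)))"
proof -
  have "(norm (\<Sum>s\<le>d. of_real (p s) * cis (x s)))\<^sup>2 = (\<Sum>s\<le>d. p s * cos (x s))\<^sup>2 + (\<Sum>s\<le>d. p s * sin (x s))\<^sup>2"
    by (simp add: cmod_power2)
  also have "\<dots> = (\<Sum>s\<le>d. \<Sum>s'\<le>d. p s * p s' * cos (x s - x s'))"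
    unfolding power2_eq_square sum_product sum.distrib[symmetric]
    by (intro sum.cong refl) (simp add: cos_diff algebra_simps)
  also have "\<dots> = (\<Sum>s\<le>d. \<Sum>s'\<le>d. p s * p s') - (\<Sum>s\<le>d. \<Sum>s'\<le>d. p s * p s' * (1 - cos (x s - x s')))"
    by (simp add: sum_subtractf right_diff_distrib)
  also have "(\<Sum>s\<le>d. \<Sum>s'\<le>d. p s * p s') = 1"
    using one by (simp add: sum_product[symmetric])
  finally have eq: "(norm (\<Sum>s\<le>d. of_real (p s) * cis (x s)))\<^sup>2 =
      1 - (\<Sum>s\<le>d. \<Sum>s'\<le>d. p s * p s' * (1 - cos (x s - x s')))" .
  have nn: "0 \<le> p s * p s' * (1 - cos (x s - x s'))" if "s \<le> d" "s' \<le> d" for s s'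
    using p that by (intro mult_nonneg_nonneg) auto
  have "(\<Sum>s<d. p s * p d * (1 - cos (x s - x d))) \<le> (\<Sum>s\<le>d. p s * p d * (1 - cos (x s - x d)))"
    by (intro sum_mono2) (use nn in auto)
  also have "\<dots> \<le> (\<Sum>s\<le>d. \<Sum>s'\<le>d. p s * p s' * (1 - cos (x s - x s')))"
    by (intro sum_mono member_le_sum) (use nn in auto)
  finally show ?thesis unfolding eq by simp
qed

text \<open>The majorant for dominated convergence. Row block 0 alone supplies the decay, all other
  factors having modulus at most 1. Inside the box every scaled frequency is at most
  \<open>pi\<close> in absolute value, so the quadratic bound on the cosine applies.\<close>

lemma (in positive_doubly_stochastic) char_prod_bound:
  obtains c where "c > 0" and
    "\<And>n y. n > 0 \<Longrightarrow> norm (box_indicator d n y *\<^sub>R char_prod d t n (pinned d y)) \<le> exp (- c * (\<Sum>s<d. (y s)\<^sup>2))"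
proof -
  define \<delta> where "\<delta> = Min ((\<lambda>s. t 0 s * t 0 d) ` {..d})"
  have \<delta>: "\<delta> > 0" unfolding \<delta>_def by (subst Min_gr_iff) (auto intro!: mult_pos_pos pos)
  have \<delta>_le: "\<delta> \<le> t 0 s * t 0 d" if "s \<le> d" for s
    unfolding \<delta>_def using that by (intro Min_le) auto
  \<comment> \<open>The cosine bound gives \<delta>/18 for the squared modulus; the square root
    halves it to \<delta>/36, and the \<open>n\<close>-th power cancels the \<open>1 / n\<close>
    from the scaling.\<close>
  have "norm (box_indicator d n y *\<^sub>R char_prod d t n (pinned d y)) \<le> exp (- (\<delta> / 36) * (\<Sum>s<d. (y s)\<^sup>2))"
    if n: "n > 0" for n y
  proof (cases "\<forall>s<d. y s \<in> {- (pi * sqrt n)..pi * sqrt n}")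
    case False
    then have "box_indicator d n y = 0"
      unfolding box_indicator_def by (intro prod_zero) (auto simp: indicator_def)
    then show ?thesis by simp
  next
    case True
    then have box: "box_indicator d n y = 1" by (simp add: box_indicator_def)
    define Y where "Y = (\<Sum>s<d. (y s)\<^sup>2)"
    define x where "x = (\<lambda>r s. (pinned d y s - row_mean d t (pinned d y) r) / sqrt n)"
    define z where "z = (\<lambda>r. \<Sum>s\<le>d. of_real (t r s) * cis (x r s))"
    have sn: "sqrt n > 0" using n by simp
    have z1: "norm (z r) \<le> 1" if "r \<le> d" for r
      unfolding z_def using that pos[of r] row_sum[of r]
      by (intro norm_weighted_cis_sum_le_1) (auto intro: less_imp_le)
    have "(norm (z 0))\<^sup>2 \<le> 1 - (\<Sum>s<d. t 0 s * t 0 d * (1 - cos (x 0 s - x 0 d)))"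
      unfolding z_def using pos[of 0] row_sum[of 0]
      by (intro norm_weighted_cis_sum_le) (auto intro: less_imp_le)
    also have "\<dots> \<le> 1 - (\<Sum>s<d. \<delta> * ((y s / sqrt n)\<^sup>2 / 18))"
    proof (intro diff_left_mono sum_mono mult_mono)
      fix s assume s: "s \<in> {..<d}"
      \<comment> \<open>The row mean cancels in the difference and coordinate \<open>d\<close> is
        pinned to 0.\<close>
      have "x 0 s - x 0 d = y s / sqrt n"
        using s by (simp add: x_def pinned_def diff_divide_distrib)
      moreover have "\<bar>y s / sqrt n\<bar> \<le> pi"
      proof -
        have "\<bar>y s\<bar> \<le> pi * sqrt n" using True s by (auto simp: abs_le_iff)
        then show ?thesis using sn by (simp add: abs_divide pos_divide_le_eq)
      qed
      ultimately show "(y s / sqrt n)\<^sup>2 / 18 \<le> 1 - cos (x 0 s - x 0 d)"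
        using one_minus_cos_ge by metis
    qed (auto intro!: \<delta>_le mult_nonneg_nonneg less_imp_le[OF pos])
    also have "(\<Sum>s<d. \<delta> * ((y s / sqrt n)\<^sup>2 / 18)) = \<delta> / 18 * Y / n"
      unfolding Y_def by (simp add: power_divide sum_distrib_left sum_divide_distrib mult.commute)
    also have "1 - \<delta> / 18 * Y / n \<le> exp (- (\<delta> / 18 * Y / n))"
      using exp_ge_add_one_self[of "- (\<delta> / 18 * Y / n)"] by simp
    also have "\<dots> = (exp (- (\<delta> / 36 * Y / n)))\<^sup>2"
      by (simp add: power2_eq_square exp_add[symmetric])
    finally have "norm (z 0) \<le> exp (- (\<delta> / 36 * Y / n))"
      by (rule power2_le_imp_le) simp
    then have "norm (z 0) ^ n \<le> exp (- (\<delta> / 36 * Y / n)) ^ n"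
      by (intro power_mono) auto
    also have "\<dots> = exp (- (\<delta> / 36) * Y)"
      using n by (simp add: exp_of_nat_mult[symmetric])
    finally have z0: "norm (z 0) ^ n \<le> exp (- (\<delta> / 36) * Y)" .
    have "norm (char_prod d t n (pinned d y)) = (\<Prod>r\<le>d. norm (z r) ^ n)"
      by (simp add: char_prod_def z_def x_def prod_norm[symmetric] norm_power)
    also have "\<dots> = norm (z 0) ^ n * (\<Prod>r\<in>{..d} - {0}. norm (z r) ^ n)"
      by (rule prod.remove) auto
    also have "\<dots> \<le> norm (z 0) ^ n * 1"
      using z1 by (intro mult_left_mono prod_le_1) (auto intro: power_le_one)
    finally show ?thesis using z0 by (simp add: box Y_def)
  qed
  then show thesis using \<delta> by (intro that[of "\<delta> / 36"]) auto
qed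

section \<open>Passage to the limit by dominated convergence\<close>

lemma measurable_pinned [measurable]:
  "(\<lambda>y. pinned d y s) \<in> borel_measurable (PiM {..<d} (\<lambda>_. lborel))"
proof (cases "s < d")
  case True
  then show ?thesis
    using measurable_component_singleton[of s "{..<d}" "\<lambda>_. lborel :: real measure"]
    by (simp add: pinned_def)
qed (simp add: pinned_def)

lemma integrable_gaussian_PiM:
  fixes c :: real and d :: nat
  assumes c: "c > 0"
  shows "integrable (PiM {..<d} (\<lambda>_. lborel)) (\<lambda>y. exp (- c * (\<Sum>s<d. (y s)\<^sup>2)))"
proof -
  have "integrable lborel (\<lambda>x :: real. exp (- c * x\<^sup>2))"
  proof (rule integrableI_nonneg)
    have "(\<integral>\<^sup>+x. ennreal (exp (- c * x\<^sup>2)) \<partial>lborel) = ennreal (sqrt (2 * pi / (2 * c)))"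
      using nn_integral_gaussian[of "2 * c" 0] c by simp
    then show "(\<integral>\<^sup>+x. ennreal (exp (- c * x\<^sup>2)) \<partial>lborel) < \<infinity>" by simp
  qed auto
  then have "integrable (PiM {..<d} (\<lambda>_. lborel)) (\<lambda>y. \<Prod>s<d. exp (- c * (y s)\<^sup>2))"
    using lborel_product.product_integrable_prod[of "{..<d}" "\<lambda>_ x. exp (- c * x\<^sup>2)"] by simp
  then show ?thesis
    by (simp add: exp_sum[symmetric] sum_distrib_left sum_negf)
qed

definition dispersion_integral :: "nat \<Rightarrow> (nat \<Rightarrow> nat \<Rightarrow> real) \<Rightarrow> real" where
  "dispersion_integral d t =
     (\<integral>y. exp (- dispersion d t (pinned d y) / 2) \<partial>PiM {..<d} (\<lambda>_. lborel))"

text \<open>Each row block contributes one factor of the central limit theorem, and the variances in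
  the exponents add up to the dispersion.\<close>

lemma (in positive_doubly_stochastic) char_prod_tendsto:
  "(\<lambda>n. char_prod d t n x) \<longlonglongrightarrow> of_real (exp (- dispersion d t x / 2))"
proof -
  have "(\<lambda>n. char_prod d t n x) \<longlonglongrightarrow>
     (\<Prod>r\<le>d. of_real (exp (- (\<Sum>s\<le>d. t r s * (x s - row_mean d t x r)\<^sup>2) / 2)))"
    unfolding char_prod_def
  proof (intro tendsto_prod weighted_cis_sum_power_tendsto)
    fix r assume r: "r \<in> {..d}"
    show "(\<Sum>s\<le>d. t r s * (x s - row_mean d t x r)) = 0"
      using r by (simp add: right_diff_distrib sum_subtractf row_mean_def[symmetric]
          sum_distrib_right[symmetric] row_sum)
  qed (auto intro: less_imp_le pos simp: row_sum)
  also have "(\<Prod>r\<le>d. of_real (exp (- (\<Sum>s\<le>d. t r s * (x s - row_mean d t x r)\<^sup>2) / 2))) =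
     complex_of_real (exp (- dispersion d t x / 2))"
    by (simp add: dispersion_def exp_sum[symmetric] sum_negf[symmetric] sum_divide_distrib
        of_real_prod[symmetric] del: of_real_prod)
  finally show ?thesis .
qed

lemma box_indicator_tendsto: "(\<lambda>n. box_indicator d n y) \<longlonglongrightarrow> 1"
proof (rule tendsto_eventually)
  have "\<forall>\<^sub>F n :: nat in sequentially. \<bar>y s\<bar> \<le> pi * sqrt n" for s
  proof -
    have "filterlim (\<lambda>n :: nat. pi * sqrt n) at_top sequentially" by real_asymp
    then show ?thesis by (simp add: filterlim_at_top)
  qed
  then have "\<forall>\<^sub>F n :: nat in sequentially. \<forall>s\<in>{..<d}. \<bar>y s\<bar> \<le> pi * sqrt n"
    by (intro eventually_ball_finite) auto
  then show "\<forall>\<^sub>F n in sequentially. box_indicator d n y = 1"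
  proof eventually_elim
    case (elim n)
    show ?case
      unfolding box_indicator_def
    proof (intro prod.neutral ballI)
      fix s assume "s \<in> {..<d}"
      with elim have "\<bar>y s\<bar> \<le> pi * sqrt n" by blast
      then show "indicator {- (pi * sqrt n)..pi * sqrt n} (y s) = (1 :: real)"
        by (simp add: indicator_def abs_le_iff)
    qed
  qed
qed

text \<open>Dominated convergence yields both the limit and the integrability of the limiting
  Gaussian. The factor \<open>(2 * pi * sqrt n) ^ d\<close> is the volume of the enlarged torus from
  Fourier inversion.\<close>

lemma (in positive_doubly_stochastic)
  shows integrable_dispersion:
      "integrable (PiM {..<d} (\<lambda>_. lborel)) (\<lambda>y. exp (- dispersion d t (pinned d y) / 2))"
    and balanced_sum_tendsto:
      "(\<lambda>n. (2 * pi * sqrt n) ^ d * (\<Sum>f\<in>balanced d n. \<Prod>i<Suc d * n. t (i div n) (f i)))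
         \<longlonglongrightarrow> dispersion_integral d t"
proof -
  let ?M = "PiM {..<d} (\<lambda>_. lborel :: real measure)"
  obtain c where c: "c > 0" and bound:
    "\<And>n y. n > 0 \<Longrightarrow> norm (box_indicator d n y *\<^sub>R char_prod d t n (pinned d y)) \<le> exp (- c * (\<Sum>s<d. (y s)\<^sup>2))"
    using char_prod_bound by blast
  \<comment> \<open>The index is shifted to \<open>Suc n\<close> because the majorant holds for
    positive \<open>n\<close> only, while dominated convergence wants it for every term.\<close>
  define F where "F = (\<lambda>n y. box_indicator d (Suc n) y *\<^sub>R char_prod d t (Suc n) (pinned d y))"
  define G where "G = (\<lambda>y. complex_of_real (exp (- dispersion d t (pinned d y) / 2)))"
  have box_meas [measurable]: "box_indicator d n \<in> borel_measurable ?M" for n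
  proof -
    \<comment> \<open>Replacing \<open>y s\<close> by \<open>pinned d y s\<close> changes nothing
      for \<open>s < d\<close>, but makes each factor measurable without a side condition on
      \<open>s\<close>.\<close>
    have "(\<lambda>y. \<Prod>s<d. indicator {- (pi * sqrt n)..pi * sqrt n} (pinned d y s) :: real) \<in> borel_measurable ?M"
      by measurable
    also have "(\<lambda>y. \<Prod>s<d. indicator {- (pi * sqrt n)..pi * sqrt n} (pinned d y s)) = box_indicator d n"
      by (simp add: fun_eq_iff box_indicator_def pinned_def)
    finally show ?thesis .
  qed
  have row_meas [measurable]: "(\<lambda>y. row_mean d t (pinned d y) r) \<in> borel_measurable ?M" for r
    unfolding row_mean_def by measurable
  have cis_meas [measurable]: "cis \<in> borel_measurable borel"
    by (intro borel_measurable_continuous_onI continuous_intros)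
  have meas: "F n \<in> borel_measurable ?M" for n
    unfolding F_def char_prod_def by measurable
  have Gm: "G \<in> borel_measurable ?M"
    unfolding G_def dispersion_def by measurable
  have lim: "(\<lambda>n. F n y) \<longlonglongrightarrow> G y" for y
  proof -
    have "(\<lambda>n. box_indicator d n y *\<^sub>R char_prod d t n (pinned d y)) \<longlonglongrightarrow> 1 *\<^sub>R G y"
      unfolding G_def by (intro tendsto_scaleR box_indicator_tendsto char_prod_tendsto)
    from LIMSEQ_Suc[OF this] show ?thesis by (simp add: F_def)
  qed
  have FB: "norm (F n y) \<le> exp (- c * (\<Sum>s<d. (y s)\<^sup>2))" for n y
    unfolding F_def by (rule bound) simp
  have "integrable ?M G"
    by (rule integrable_dominated_convergence[where s = F, OF Gm meas integrable_gaussian_PiM[OF c]])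
      (use lim FB in auto)
  then show int: "integrable ?M (\<lambda>y. exp (- dispersion d t (pinned d y) / 2))"
    unfolding G_def using complex_of_real_integrable_eq by blast
  have "(\<lambda>n. integral\<^sup>L ?M (F n)) \<longlonglongrightarrow> integral\<^sup>L ?M G"
    by (rule integral_dominated_convergence[where s = F, OF Gm meas integrable_gaussian_PiM[OF c]])
      (use lim FB in auto)
  also have "integral\<^sup>L ?M G = of_real (dispersion_integral d t)"
    unfolding G_def dispersion_integral_def by (rule integral_complex_of_real)
  also have "(\<lambda>n. integral\<^sup>L ?M (F n)) = (\<lambda>n. of_real ((2 * pi * sqrt (Suc n)) ^ d *
      (\<Sum>f\<in>balanced d (Suc n). \<Prod>i<Suc d * Suc n. t (i div Suc n) (f i))))"
    unfolding F_def by (subst integral_box_char_prod) auto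
  finally have "(\<lambda>n. (2 * pi * sqrt (Suc n)) ^ d *
      (\<Sum>f\<in>balanced d (Suc n). \<Prod>i<Suc d * Suc n. t (i div Suc n) (f i))) \<longlonglongrightarrow> dispersion_integral d t"
    unfolding tendsto_of_real_iff .
  then show "(\<lambda>n. (2 * pi * sqrt n) ^ d * (\<Sum>f\<in>balanced d n. \<Prod>i<Suc d * n. t (i div n) (f i)))
         \<longlonglongrightarrow> dispersion_integral d t"
    by (rule LIMSEQ_imp_Suc)
qed

subsection \<open>Evaluation of the limiting integral\<close>

lemma dispersion_cong: "(\<And>s. s \<le> d \<Longrightarrow> x s = x' s) \<Longrightarrow> dispersion d t x = dispersion d t x'"
  by (simp add: dispersion_def row_mean_def)

context positive_doubly_stochastic
begin

lemma dispersion_shift: "dispersion d t (\<lambda>s. x s + c) = dispersion d t x"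
proof -
  have "row_mean d t (\<lambda>s. x s + c) r = row_mean d t x r + c" if "r \<le> d" for r
    using that by (simp add: row_mean_def distrib_left sum.distrib sum_distrib_right[symmetric] row_sum)
  then show ?thesis by (simp add: dispersion_def)
qed

text \<open>Variance is second moment minus squared mean; unit column sums collapse the second
  moments to the squared length of \<open>x\<close>. The result is the form of
  \<open>I - T\<^sup>* T\<close>.\<close>

lemma dispersion_eq: "dispersion d t x = (\<Sum>s\<le>d. (x s)\<^sup>2) - (\<Sum>r\<le>d. (row_mean d t x r)\<^sup>2)"
proof -
  have "(\<Sum>s\<le>d. t r s * (x s - row_mean d t x r)\<^sup>2) = (\<Sum>s\<le>d. t r s * (x s)\<^sup>2) - (row_mean d t x r)\<^sup>2"
    if r: "r \<le> d" for r
  proof -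
    define a where "a = row_mean d t x r"
    have "(\<Sum>s\<le>d. t r s * (x s - a)\<^sup>2) =
        (\<Sum>s\<le>d. t r s * (x s)\<^sup>2 - 2 * a * (t r s * x s) + a\<^sup>2 * t r s)"
      by (intro sum.cong refl) (simp add: power2_eq_square algebra_simps)
    also have "\<dots> = (\<Sum>s\<le>d. t r s * (x s)\<^sup>2) - 2 * a * a + a\<^sup>2 * 1"
      unfolding sum.distrib sum_subtractf sum_distrib_left[symmetric] row_sum[OF r]
      by (simp add: a_def row_mean_def)
    finally show ?thesis by (simp add: a_def power2_eq_square)
  qed
  then have "dispersion d t x = (\<Sum>r\<le>d. \<Sum>s\<le>d. t r s * (x s)\<^sup>2) - (\<Sum>r\<le>d. (row_mean d t x r)\<^sup>2)"
    by (simp add: dispersion_def sum_subtractf)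
  also have "(\<Sum>r\<le>d. \<Sum>s\<le>d. t r s * (x s)\<^sup>2) = (\<Sum>s\<le>d. (\<Sum>r\<le>d. t r s) * (x s)\<^sup>2)"
    by (subst sum.swap) (simp add: sum_distrib_right)
  finally show ?thesis by (simp add: col_sum)
qed

text \<open>The dispersion is invariant under adding a constant, so the coordinate pinned to 0 can be
  restored by integrating over all shifts; the extra square makes that integral finite.\<close>

lemma nn_integral_dispersion_unpinned:
  "(\<integral>\<^sup>+x. ennreal (exp (- (dispersion d t x + (\<Sum>s\<le>d. x s)\<^sup>2 / Suc d) / 2)) \<partial>PiM {..<Suc d} (\<lambda>_. lborel)) =
   ennreal (dispersion_integral d t * sqrt (2 * pi / Suc d))"
proof -
  let ?M = "PiM {..<d} (\<lambda>_. lborel :: real measure)"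
  let ?h = "\<lambda>x. ennreal (exp (- (dispersion d t x + (\<Sum>s\<le>d. x s)\<^sup>2 / Suc d) / 2))"
  let ?g = "\<lambda>y u. ennreal (exp (- (dispersion d t (pinned d y) + real (Suc d) * (u + (\<Sum>s\<le>d. pinned d y s) / Suc d)\<^sup>2) / 2))"
  have ins: "{..<Suc d} = insert d {..<d}" by auto
  have comp: "(\<lambda>x. x s) \<in> borel_measurable (PiM {..<Suc d} (\<lambda>_. lborel :: real measure))"
    if "s \<in> {..d}" for s
    using measurable_component_singleton[of s "{..<Suc d}" "\<lambda>_. lborel :: real measure"] that by simp
  have meas: "?h \<in> borel_measurable (PiM {..<Suc d} (\<lambda>_. lborel))"
  proof -
    note comp [measurable]
    show ?thesis unfolding dispersion_def row_mean_def by measurable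
  qed
  have upd: "(\<lambda>y. y(d := u)) \<in> measurable ?M (PiM {..<Suc d} (\<lambda>_. lborel))" for u :: real
    unfolding ins by (rule measurable_fun_upd[where J = "{..<d}"]) auto
  \<comment> \<open>The last coordinate \<open>u\<close> becomes the outer variable, so that for
    fixed \<open>u\<close> all others can be translated by \<open>u\<close>.\<close>
  have "(\<integral>\<^sup>+x. ?h x \<partial>PiM {..<Suc d} (\<lambda>_. lborel)) = (\<integral>\<^sup>+u. (\<integral>\<^sup>+y. ?h (y(d := u)) \<partial>?M) \<partial>lborel)"
    using lborel_product.product_nn_integral_insert_rev[OF _ _ meas[unfolded ins], folded ins] by simp
  also have "\<dots> = (\<integral>\<^sup>+u. (\<integral>\<^sup>+y. ?g y u \<partial>?M) \<partial>lborel)"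
  proof (rule nn_integral_cong)
    fix u :: real
    have "(\<lambda>y. ?h (y(d := u))) \<in> borel_measurable ?M"
      by (rule measurable_compose[OF upd meas])
    then have "(\<integral>\<^sup>+y. ?h (y(d := u)) \<partial>?M) = (\<integral>\<^sup>+y. ?h ((\<lambda>i\<in>{..<d}. u + y i)(d := u)) \<partial>?M)"
      using nn_integral_PiM_lborel_shift[of "{..<d}" "\<lambda>y. ?h (y(d := u))" u] by simp
    also have "\<dots> = (\<integral>\<^sup>+y. ?g y u \<partial>?M)"
    proof (rule nn_integral_cong)
      fix y :: "nat \<Rightarrow> real"
      have *: "((\<lambda>i\<in>{..<d}. u + y i)(d := u)) s = pinned d y s + u" if "s \<le> d" for s
        using that by (auto simp: pinned_def)
      have "dispersion d t ((\<lambda>i\<in>{..<d}. u + y i)(d := u)) = dispersion d t (\<lambda>s. pinned d y s + u)"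
        by (rule dispersion_cong) (rule *)
      then have "dispersion d t ((\<lambda>i\<in>{..<d}. u + y i)(d := u)) = dispersion d t (pinned d y)"
        unfolding dispersion_shift .
      moreover have "(\<Sum>s\<le>d. ((\<lambda>i\<in>{..<d}. u + y i)(d := u)) s) = real (Suc d) * (u + (\<Sum>s\<le>d. pinned d y s) / Suc d)"
      proof -
        have "(\<Sum>s\<le>d. ((\<lambda>i\<in>{..<d}. u + y i)(d := u)) s) = (\<Sum>s\<le>d. pinned d y s + u)"
          by (intro sum.cong refl) (simp only: * atMost_iff)
        then show ?thesis by (simp add: sum.distrib field_simps)
      qed
      moreover have "(real (Suc d) * z)\<^sup>2 / real (Suc d) = real (Suc d) * z\<^sup>2" for z
        by (simp add: power2_eq_square)
      ultimately show "?h ((\<lambda>i\<in>{..<d}. u + y i)(d := u)) = ?g y u" by presburger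
    qed
    finally show "(\<integral>\<^sup>+y. ?h (y(d := u)) \<partial>?M) = (\<integral>\<^sup>+y. ?g y u \<partial>?M)" .
  qed
  \<comment> \<open>Now \<open>u\<close> occurs only in the extra square; swapping the order makes
    its integral a one-dimensional Gaussian.\<close>
  also have "\<dots> = (\<integral>\<^sup>+y. (\<integral>\<^sup>+u. ?g y u \<partial>lborel) \<partial>?M)"
  proof -
    interpret pair_sigma_finite ?M "lborel :: real measure"
      by (intro pair_sigma_finite.intro lborel_product.sigma_finite lborel.sigma_finite_measure_axioms) auto
    show ?thesis
      by (rule Fubini') (unfold dispersion_def row_mean_def, measurable)
  qed
  also have "\<dots> = (\<integral>\<^sup>+y. ennreal (exp (- dispersion d t (pinned d y) / 2)) * ennreal (sqrt (2 * pi / Suc d)) \<partial>?M)"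
  proof (rule nn_integral_cong)
    fix y :: "nat \<Rightarrow> real"
    let ?c = "(\<Sum>s\<le>d. pinned d y s) / Suc d"
    have "(\<integral>\<^sup>+u. ?g y u \<partial>lborel) = (\<integral>\<^sup>+u. ennreal (exp (- dispersion d t (pinned d y) / 2)) *
        ennreal (exp (- (real (Suc d) * (u + ?c)\<^sup>2) / 2)) \<partial>lborel)"
      by (intro nn_integral_cong) (simp add: ennreal_mult[symmetric] exp_add[symmetric] add_divide_distrib[symmetric] del: of_nat_Suc)
    also have "\<dots> = ennreal (exp (- dispersion d t (pinned d y) / 2)) *
        (\<integral>\<^sup>+u. ennreal (exp (- (real (Suc d) * (u + ?c)\<^sup>2) / 2)) \<partial>lborel)"
      by (rule nn_integral_cmult) measurable
    also have "(\<integral>\<^sup>+u. ennreal (exp (- (real (Suc d) * (u + ?c)\<^sup>2) / 2)) \<partial>lborel) = ennreal (sqrt (2 * pi / Suc d))"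
      by (rule nn_integral_gaussian) simp
    finally show "(\<integral>\<^sup>+u. ?g y u \<partial>lborel) = ennreal (exp (- dispersion d t (pinned d y) / 2)) * ennreal (sqrt (2 * pi / Suc d))" .
  qed
  also have "\<dots> = (\<integral>\<^sup>+y. ennreal (exp (- dispersion d t (pinned d y) / 2)) \<partial>?M) * ennreal (sqrt (2 * pi / Suc d))"
    by (rule nn_integral_multc) (unfold dispersion_def row_mean_def, measurable)
  also have "(\<integral>\<^sup>+y. ennreal (exp (- dispersion d t (pinned d y) / 2)) \<partial>?M) = ennreal (dispersion_integral d t)"
    unfolding dispersion_integral_def by (rule nn_integral_eq_integral[OF integrable_dispersion]) simp
  finally show ?thesis
    unfolding dispersion_integral_def by (subst ennreal_mult) (auto intro!: Bochner_Integration.integral_nonneg)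
qed

text \<open>\<open>Q\<close> represents the dispersion plus the square contributed by
  \<open>J\<close>, so the Gaussian integral of \<open>Q\<close> can be evaluated both by its
  determinant and by releasing the pinned coordinate.\<close>

lemma dispersion_integral_eq_det:
  fixes Q :: "real mat"
  assumes Q: "Q \<in> carrier_mat (Suc d) (Suc d)"
    and Q_eq: "\<And>i j. i \<le> d \<Longrightarrow> j \<le> d \<Longrightarrow>
      Q $$ (i, j) = (if i = j then 1 else 0) + 1 / Suc d - (\<Sum>r\<le>d. t r i * t r j)"
  shows "0 < Determinant.det Q"
    and "dispersion_integral d t = sqrt ((2 * pi) ^ d * Suc d / Determinant.det Q)"
proof -
  have form: "(\<Sum>i<Suc d. \<Sum>j<Suc d. Q $$ (i, j) * x i * x j) = dispersion d t x + (\<Sum>s\<le>d. x s)\<^sup>2 / Suc d" for x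
  proof -
    have "(\<Sum>i\<le>d. \<Sum>j\<le>d. Q $$ (i, j) * x i * x j) =
      (\<Sum>i\<le>d. \<Sum>j\<le>d. (if i = j then x i * x j else 0) + x i * x j / Suc d - (\<Sum>r\<le>d. (t r i * x i) * (t r j * x j)))"
      by (intro sum.cong refl) (auto simp: Q_eq algebra_simps sum_distrib_left)
    also have "\<dots> = (\<Sum>i\<le>d. (x i)\<^sup>2) + (\<Sum>s\<le>d. x s)\<^sup>2 / Suc d
        - (\<Sum>i\<le>d. \<Sum>j\<le>d. \<Sum>r\<le>d. (t r i * x i) * (t r j * x j))"
      unfolding sum.distrib sum_subtractf power2_eq_square sum_product
      by (simp add: sum_divide_distrib)
    also have "(\<Sum>i\<le>d. \<Sum>j\<le>d. \<Sum>r\<le>d. (t r i * x i) * (t r j * x j)) =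
        (\<Sum>i\<le>d. \<Sum>r\<le>d. \<Sum>j\<le>d. (t r i * x i) * (t r j * x j))"
      by (intro sum.cong refl sum.swap)
    also have "\<dots> = (\<Sum>r\<le>d. (row_mean d t x r)\<^sup>2)"
      by (subst sum.swap) (simp add: row_mean_def power2_eq_square sum_product)
    finally show ?thesis
      by (simp add: dispersion_eq lessThan_Suc_atMost)
  qed
  have posdef: "0 < (\<Sum>i<Suc d. \<Sum>j<Suc d. Q $$ (i, j) * x i * x j)" if i: "i < Suc d" "x i \<noteq> 0" for x i
  proof -
    have nonneg: "0 \<le> t r s * (x s - row_mean d t x r)\<^sup>2" if "r \<le> d" "s \<le> d" for r s
      using pos[OF that] by simp
    have disp: "0 \<le> dispersion d t x"
      unfolding dispersion_def by (intro sum_nonneg) (use nonneg in auto)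
    show ?thesis
    proof (cases "dispersion d t x = 0")
      \<comment> \<open>Since the entries in row 0 are positive, zero dispersion forces
        \<open>x\<close> to be constant; the constant is nonzero, so the square from
        \<open>J\<close> is positive.\<close>
      case True
      then have "\<forall>r\<in>{..d}. (\<Sum>s\<le>d. t r s * (x s - row_mean d t x r)\<^sup>2) = 0"
        unfolding dispersion_def by (subst (asm) sum_nonneg_eq_0_iff) (use nonneg in \<open>auto intro!: sum_nonneg\<close>)
      then have "(\<Sum>s\<le>d. t 0 s * (x s - row_mean d t x 0)\<^sup>2) = 0" by simp
      then have zero: "\<forall>s\<in>{..d}. t 0 s * (x s - row_mean d t x 0)\<^sup>2 = 0"
        by (subst (asm) sum_nonneg_eq_0_iff) (use nonneg in auto)
      have const: "x s = row_mean d t x 0" if "s \<le> d" for s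
      proof -
        have "t 0 s * (x s - row_mean d t x 0)\<^sup>2 = 0" using zero that by blast
        then show ?thesis using pos[of 0 s] that by simp
      qed
      then have "(\<Sum>s\<le>d. x s) = real (Suc d) * x i"
        using i const[of i] by simp
      then show ?thesis
        using i disp unfolding form by (simp add: add_nonneg_pos)
    next
      case False
      then have "0 < dispersion d t x" using disp by simp
      then show ?thesis unfolding form by (intro add_pos_nonneg) auto
    qed
  qed
  have sym: "Q $$ (i, j) = Q $$ (j, i)" if "i < Suc d" "j < Suc d" for i j
    using that by (simp add: Q_eq mult.commute)
  have gauss: "0 < Determinant.det Q \<and>
      (\<integral>\<^sup>+x. ennreal (exp (- (\<Sum>i<Suc d. \<Sum>j<Suc d. Q $$ (i, j) * x i * x j) / 2)) \<partial>PiM {..<Suc d} (\<lambda>_. lborel))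
        = ennreal (sqrt ((2 * pi) ^ Suc d / Determinant.det Q))"
    by (rule nn_integral_gaussian_posdef[OF Q sym posdef])
  then show det: "0 < Determinant.det Q" by blast
  have "ennreal (dispersion_integral d t * sqrt (2 * pi / Suc d)) = ennreal (sqrt ((2 * pi) ^ Suc d / Determinant.det Q))"
    using gauss unfolding form nn_integral_dispersion_unpinned by blast
  moreover have "0 \<le> dispersion_integral d t"
    unfolding dispersion_integral_def by (intro Bochner_Integration.integral_nonneg) auto
  ultimately have "dispersion_integral d t * sqrt (2 * pi / Suc d) = sqrt ((2 * pi) ^ Suc d / Determinant.det Q)"
    using det by (subst (asm) ennreal_inj) auto
  \<comment> \<open>Splitting off the factor of the released coordinate, which is then cancelled on
    both sides.\<close>
  also have "\<dots> = sqrt ((2 * pi) ^ d * Suc d / Determinant.det Q) * sqrt (2 * pi / Suc d)"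
    unfolding real_sqrt_mult[symmetric] by (simp del: of_nat_Suc)
  finally show "dispersion_integral d t = sqrt ((2 * pi) ^ d * Suc d / Determinant.det Q)"
    by simp
qed

end

section \<open>Scaling of the permanent and comparison with the uniform matrix\<close>

lemma positive_doubly_stochastic_uniform: "positive_doubly_stochastic d (\<lambda>_ _. 1 / real (Suc d))"
  by unfold_locales auto

text \<open>Every permutation meets each row and each column once, so scaling rows by
  \<open>v\<close> and columns by \<open>w\<close> multiplies every term by the same
  constant.\<close>

lemma permanent_block_scaled:
  assumes B: "B \<in> carrier_mat (Suc d) (Suc d)" and n: "n > 0"
  shows "permanent (block_matrix B n) * (\<Prod>r\<le>d. v r) ^ n * (\<Prod>s\<le>d. w s) ^ n =
    (\<Sum>p | p permutes {..<Suc d * n}. \<Prod>i<Suc d * n.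
        B $$ (i div n, p i div n) * v (i div n) * w (p i div n))"
proof -
  let ?N = "Suc d * n"
  have "permanent (block_matrix B n) = (\<Sum>p | p permutes {..<?N}. \<Prod>i<?N. B $$ (i div n, p i div n))"
    unfolding permanent_def
  proof (rule sum.cong)
    have block: "block_matrix B n = mat ?N ?N (\<lambda>(i, j). B $$ (i div n, j div n))"
      unfolding block_matrix_def ceiling_index_eq_div[OF n] using B by auto
    have dims: "dim_row (block_matrix B n) = ?N" using B by (simp add: block_matrix_def)
    show "{p. p permutes {0..<dim_row (block_matrix B n)}} = {p. p permutes {..<?N}}"
      unfolding dims atLeast0LessThan ..
    fix p assume "p \<in> {p. p permutes {..<?N}}"
    then have p: "p permutes {..<?N}" by blast
    show "(\<Prod>i = 0..<dim_row (block_matrix B n). block_matrix B n $$ (i, p i)) = (\<Prod>i<?N. B $$ (i div n, p i div n))"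
      unfolding dims atLeast0LessThan
    proof (rule prod.cong[OF refl])
      fix i assume i: "i \<in> {..<?N}"
      then have "p i \<in> {..<?N}" using permutes_in_image[OF p] by blast
      then show "block_matrix B n $$ (i, p i) = B $$ (i div n, p i div n)"
        using i unfolding block by simp
    qed
  qed
  moreover have "(\<Prod>i<?N. B $$ (i div n, p i div n) * v (i div n) * w (p i div n)) =
     (\<Prod>i<?N. B $$ (i div n, p i div n)) * (\<Prod>r\<le>d. v r) ^ n * (\<Prod>s\<le>d. w s) ^ n" if p: "p permutes {..<?N}" for p
  proof -
    \<comment> \<open>Reindexing by \<open>p\<close> turns the product over visited columns into a
      product over all columns.\<close>
    have "(\<Prod>i<?N. w (p i div n)) = (\<Prod>i<?N. w (i div n))"
      using prod.permute[OF p, of "\<lambda>i. w (i div n)"] by (simp add: o_def)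
    then show ?thesis
      using prod_div_blocks[OF n, of v d] prod_div_blocks[OF n, of w d]
      by (simp only: prod.distrib prod_power_distrib)
  qed
  ultimately show ?thesis by (simp add: sum_distrib_right)
qed


theorem theorem1:
  fixes m :: nat and B :: "real mat" and v w :: "real vec"
  assumes "m \<ge> 1"
    and "B \<in> carrier_mat m m" and "v \<in> carrier_vec m" and "w \<in> carrier_vec m"
    and "\<And>r s. r < m \<Longrightarrow> s < m \<Longrightarrow> B $$ (r, s) > 0"
    and "\<And>r. r < m \<Longrightarrow> vec_index v r > 0"
    and "\<And>s. s < m \<Longrightarrow> vec_index w s > 0"
    and "\<And>r. r < m \<Longrightarrow> (\<Sum>s<m. B $$ (r, s) * vec_index v r * vec_index w s) = 1"
    and "\<And>s. s < m \<Longrightarrow> (\<Sum>r<m. B $$ (r, s) * vec_index v r * vec_index w s) = 1"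
  shows "(\<lambda>n. 1 / fact (m * n) * permanent (block_matrix B n))
    \<sim>[at_top]
    (\<lambda>n. real m powi (- int (m * n))
            * (\<Prod>r<m. vec_index v r) powi (- int n)
            * (\<Prod>s<m. vec_index w s) powi (- int n)
          / sqrt (Determinant.det
              (1\<^sub>m m + averaging_matrix m
                - transpose_mat (scaled_matrix B v w) * scaled_matrix B v w)))"
proof -
  obtain d where m: "m = Suc d"
    using assms(1) by (cases m) auto
  have less_m: "{..<m} = {..d}" "i < m \<longleftrightarrow> i \<le> d" for i
    by (auto simp: m)
  define t where "t = (\<lambda>r s. B $$ (r, s) * vec_index v r * vec_index w s)"
  define u :: "nat \<Rightarrow> nat \<Rightarrow> real" where "u = (\<lambda>_ _. 1 / real (Suc d))"
  define Q where "Q = 1\<^sub>m m + averaging_matrix m - transpose_mat (scaled_matrix B v w) * scaled_matrix B v w"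
  define S where "S = (\<lambda>t n. \<Sum>f\<in>balanced d n. \<Prod>i<Suc d * n. t (i div n) (f i) :: real)"
  define V where "V = (\<Prod>r\<le>d. vec_index v r)"
  define W where "W = (\<Prod>s\<le>d. vec_index w s)"
  interpret T: positive_doubly_stochastic d t
    using assms(5-9) unfolding t_def less_m by unfold_locales (auto simp: m)
  interpret U: positive_doubly_stochastic d u
    unfolding u_def by (rule positive_doubly_stochastic_uniform)
  have VW: "V > 0" "W > 0"
    using assms(6,7) by (auto simp: V_def W_def less_m intro!: prod_pos)

  have Q: "Q \<in> carrier_mat (Suc d) (Suc d)"
    using assms(2) by (intro carrier_matI) (simp_all add: Q_def m scaled_matrix_def averaging_matrix_def)
  have Q_eq: "Q $$ (i, j) = (if i = j then 1 else 0) + 1 / Suc d - (\<Sum>r\<le>d. t r i * t r j)"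
    if "i \<le> d" "j \<le> d" for i j
    using assms(2) that
    by (simp add: Q_def m scaled_matrix_def averaging_matrix_def scalar_prod_def t_def
        atLeast0LessThan lessThan_Suc_atMost)
  have uniform: "(\<Sum>r\<le>d. u r i * u r j) = 1 / Suc d" for i j
    by (simp add: u_def)
  have DI: "0 < Determinant.det Q" "dispersion_integral d t = sqrt ((2 * pi) ^ d * Suc d / Determinant.det Q)"
    using T.dispersion_integral_eq_det[OF Q Q_eq] by auto
  \<comment> \<open>For the uniform matrix \<open>T\<^sup>* T\<close> equals \<open>J\<close>, so
    its quadratic form has the identity matrix, of determinant 1.\<close>
  have DI_u: "dispersion_integral d u = sqrt ((2 * pi) ^ d * Suc d)"
    using U.dispersion_integral_eq_det(2)[of "1\<^sub>m (Suc d)"] by (simp add: uniform)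

  \<comment> \<open>\<open>K\<close> is common to both matrices and cancels. For \<open>u\<close>
    all terms of the permutation sum are equal, so it is \<open>(m * n)!\<close> divided by
    \<open>m ^ (m * n)\<close>.\<close>
  have ratio: "S t n / S u n = 1 / fact (m * n) * permanent (block_matrix B n) * real m ^ (m * n) * V ^ n * W ^ n"
    if n: "n > 0" for n
  proof -
    obtain K :: nat where K: "K > 0" and perm: "\<And>t :: nat \<Rightarrow> nat \<Rightarrow> real.
      (\<Sum>p | p permutes {..<Suc d * n}. \<Prod>i<Suc d * n. t (i div n) (p i div n)) = real K * S t n"
      unfolding S_def using sum_permutes_eq_sum_balanced[OF n, of d] by blast
    have "real K * S t n = permanent (block_matrix B n) * V ^ n * W ^ n"
      unfolding perm[symmetric] V_def W_def t_def
      by (rule permanent_block_scaled[OF _ n, symmetric]) (use assms(2) m in auto)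
    moreover have "real K * S u n = fact (m * n) / real m ^ (m * n)"
      unfolding perm[symmetric] u_def
      by (simp add: card_permutations[OF refl] m power_divide del: of_nat_Suc mult_Suc)
    ultimately have "S t n / S u n = permanent (block_matrix B n) * V ^ n * W ^ n / (fact (m * n) / real m ^ (m * n))"
      using K by (metis mult_divide_mult_cancel_left of_nat_0_less_iff less_irrefl)
    then show ?thesis by simp
  qed

  \<comment> \<open>The normalising factor makes numerator and denominator converge separately; it
    is nonzero for \<open>n > 0\<close> and therefore eventually cancels.\<close>
  have "(\<lambda>n. ((2 * pi * sqrt n) ^ d * S t n) / ((2 * pi * sqrt n) ^ d * S u n)) \<longlonglongrightarrow>
      dispersion_integral d t / dispersion_integral d u"
    unfolding S_def
    by (intro tendsto_divide T.balanced_sum_tendsto U.balanced_sum_tendsto) (simp add: DI_u)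
  also have "dispersion_integral d t / dispersion_integral d u = 1 / sqrt (Determinant.det Q)"
    using DI by (simp add: DI_u real_sqrt_divide del: of_nat_Suc)
  finally have "(\<lambda>n. S t n / S u n) \<longlonglongrightarrow> 1 / sqrt (Determinant.det Q)"
    by (rule Lim_transform_eventually) (use eventually_gt_at_top[of 0] in eventually_elim, simp)
  then have "(\<lambda>n. S t n / S u n * sqrt (Determinant.det Q)) \<longlonglongrightarrow> 1 / sqrt (Determinant.det Q) * sqrt (Determinant.det Q)"
    by (rule tendsto_mult_right)
  then have lim: "(\<lambda>n. S t n / S u n * sqrt (Determinant.det Q)) \<longlonglongrightarrow> 1"
    using DI(1) by simp
  show ?thesis
    unfolding Q_def[symmetric] less_m V_def[symmetric] W_def[symmetric]
  proof (rule asymp_equivI')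
    show "(\<lambda>n. 1 / fact (m * n) * permanent (block_matrix B n) /
        (real m powi (- int (m * n)) * V powi (- int n) * W powi (- int n) / sqrt (Determinant.det Q))) \<longlonglongrightarrow> 1"
      by (rule Lim_transform_eventually[OF lim], use eventually_gt_at_top[of 0] in eventually_elim)
        (use DI(1) VW in \<open>simp add: ratio power_int_minus field_simps del: of_nat_mult\<close>)
  qed
qed

end
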